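(* Let $K\subset[0,1]$ be the attractor of a homogeneous linear iterated function system $\{\phi_j(x)=\rho x+a_j\}_{j=1}^L$ satisfying the strong separation condition, let $T:K\to K$ be the map induced by the shift, and let $\gamma:=\dim_H K=\frac{\log L}{-\log\rho}$. Let $\varphi:\mathbb{N}\to\mathbb{R}^+$ be any positive function and set $$R(\varphi):=\{x\in K:\ |T^n x-x|<\varphi(n)\ \text{for infinitely many } n\in\mathbb{N}\}.$$ Let $f$ be a doubling dimension function such that $r^{-\gamma}f(r)$ is increasing as $r\to0$. Then $$\mathcal{H}^f(R(\varphi))=\begin{cases}0, & \text{if } \sum_{n\ge1}f\big(\rho^n\varphi(n)\big)\,\rho^{-\gamma n}<\infty;\\ \mathcal{H}^f(K), & \text{if } \sum_{n\ge1}f\big(\rho^n\varphi(n)\big)\,\rho^{-\gamma n}=\infty.\end{cases}$$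
   Context: Setting. Let $L\ge 2$ be an integer, $\rho\in(0,1)$, and $0\le a_1<\cdots<a_L\le 1-\rho$. Put $\phi_j(x)=\rho x+a_j$ on $[0,1]$ for $1\le j\le L$. The attractor $K$ is the unique non-empty compact subset of $[0,1]$ with $K=\bigcup_{j=1}^L\phi_j(K)$. The strong separation condition means that the sets $\phi_1(K),\dots,\phi_L(K)$ are pairwise disjoint (as a consequence $\rho<1/L$). Coding. Let $\Lambda=\{1,\dots,L\}$. For $\epsilon=(\epsilon_1,\epsilon_2,\dots)\in\Lambda^{\mathbb{N}}$ let $\pi(\epsilon)$ be the unique point of $\bigcap_{n\ge1}\phi_{\epsilon_1}\circ\cdots\circ\phi_{\epsilon_n}([0,1])$. Then $K=\pi(\Lambda^{\mathbb{N}})$, and each $x\in K$ has a unique coding, i.e. a unique $\epsilon$ with $\pi(\epsilon)=x$. Map. $T:K\to K$ is defined by $Tx=\pi(\sigma(\epsilon))$ where $\epsilon$ is the coding of $x$ and $\sigma$ is the left shift on $\Lambda^{\mathbb{N}}$. Hausdorff measures. A dimension function is a continuous, non-decreasing $f:\mathbb{R}^+\to\mathbb{R}^+$ with $f(r)\to0$ as $r\to0$. It is doubling if there is $\lambda\ge1$ with $f(2r)\le\lambda f(r)$ for all small $r$. "$r^{-\gamma}f(r)$ is increasing as $r\to 0$" means that $r^{-\gamma}f(r)$ increases (weakly) as $r$ decreases to $0$. For a subset $F$ of a separable metric space $X$ (here $X=K$ with the Euclidean metric), $$\mathcal{H}^f(F)=\lim_{\tau\to0}\inf\Big\{\sum_{i\ge1}f(2r_i):\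 F\subset\bigcup_{i\ge 1}B(x_i,r_i),\ r_i\le\tau \text{ for all } i\Big\},$$ the infimum being over countable collections of open balls $B(x_i,r_i)$ in $X$. Here $\dim_H$ is Hausdorff dimension, $|\cdot|$ is the Euclidean metric, $\mathbb{N}=\{1,2,\dots\}$, and $\mathbb{R}^+=(0,\infty)$. *)

theory Defs
  imports "HOL-Analysis.Analysis"
begin

section \<open>Hausdorff measures and dimension\<close>

text \<open>
  The ambient separable metric space is a subset \<open>X\<close> of a metric space type, so the ball
  \<open>B(x, r)\<close> of \<open>X\<close> is \<open>ball x r \<inter> X\<close> with centre \<open>x \<in> X\<close>. Covers are indexed by an arbitrary
  \<open>I \<subseteq> \<nat>\<close>, so that finite covers (and the empty cover) are admitted as well as infinite ones.
\<close>

definition hausdorff_cover ::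
  "'a::metric_space set \<Rightarrow> real \<Rightarrow> 'a set \<Rightarrow> nat set \<Rightarrow> (nat \<Rightarrow> 'a) \<Rightarrow> (nat \<Rightarrow> real) \<Rightarrow> bool" where
  "hausdorff_cover X \<tau> F I x r \<longleftrightarrow>
     (\<forall>i\<in>I. x i \<in> X \<and> 0 < r i \<and> r i \<le> \<tau>) \<and> F \<subseteq> (\<Union>i\<in>I. ball (x i) (r i) \<inter> X)"

definition hausdorff_content ::
  "'a::metric_space set \<Rightarrow> (real \<Rightarrow> real) \<Rightarrow> real \<Rightarrow> 'a set \<Rightarrow> ennreal" where
  "hausdorff_content X f \<tau> F =
     Inf {\<Sum>\<^sub>\<infinity>i\<in>I. ennreal (f (2 * r i)) | I x r. hausdorff_cover X \<tau> F I x r}"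

definition hausdorff_measure ::
  "'a::metric_space set \<Rightarrow> (real \<Rightarrow> real) \<Rightarrow> 'a set \<Rightarrow> ennreal" where
  "hausdorff_measure X f F = Lim (at_right 0) (\<lambda>\<tau>. hausdorff_content X f \<tau> F)"

lemma hausdorff_content_antimono:
  assumes "\<sigma> \<le> \<tau>"
  shows "hausdorff_content X f \<tau> F \<le> hausdorff_content X f \<sigma> F"
  unfolding hausdorff_content_def hausdorff_cover_def
  using assms by (intro Inf_superset_mono) (blast intro: order_trans)

lemma tendsto_hausdorff_content:
  "((\<lambda>\<tau>. hausdorff_content X f \<tau> F) \<longlongrightarrow> (SUP \<tau>\<in>{0<..}. hausdorff_content X f \<tau> F)) (at_right 0)"
proof (rule order_tendstoI)
  fix b assume "b < (SUP \<tau>\<in>{0<..}. hausdorff_content X f \<tau> F)"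
  then obtain s where s: "s > 0" "b < hausdorff_content X f s F"
    by (auto simp: less_SUP_iff)
  then have "b < hausdorff_content X f \<tau> F" if "\<tau> < s" for \<tau>
    using that by (meson hausdorff_content_antimono less_imp_le order_less_le_trans)
  with s show "\<forall>\<^sub>F \<tau> in at_right 0. b < hausdorff_content X f \<tau> F"
    unfolding eventually_at_right_field by blast
next
  fix b assume b: "(SUP \<tau>\<in>{0<..}. hausdorff_content X f \<tau> F) < b"
  have "hausdorff_content X f \<tau> F < b" if "\<tau> > 0" for \<tau>
    using that by (intro le_less_trans[OF _ b] SUP_upper) auto
  then show "\<forall>\<^sub>F \<tau> in at_right 0. hausdorff_content X f \<tau> F < b"
    unfolding eventually_at_right_field by (meson zero_less_one)
qed

lemma hausdorff_measure_eq_SUP: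
  "hausdorff_measure X f F = (SUP \<tau>\<in>{0<..}. hausdorff_content X f \<tau> F)"
  unfolding hausdorff_measure_def
  by (intro tendsto_Lim tendsto_hausdorff_content) simp

definition hausdorff_dim :: "'a::metric_space set \<Rightarrow> 'a set \<Rightarrow> ennreal" where
  "hausdorff_dim X F =
     (INF s\<in>{s. 0 \<le> s \<and> hausdorff_measure X (\<lambda>r. r powr s) F = 0}. ennreal s)"

text \<open>Dimension functions live on the open half-line; values at \<open>r \<le> 0\<close> are irrelevant.\<close>

definition dimension_function :: "(real \<Rightarrow> real) \<Rightarrow> bool" where
  "dimension_function f \<longleftrightarrow>
     (\<forall>r>0. 0 < f r) \<and> continuous_on {0<..} f \<and> mono_on {0<..} f \<and> (f \<longlongrightarrow> 0) (at_right 0)"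

definition doubling :: "(real \<Rightarrow> real) \<Rightarrow> bool" where
  "doubling f \<longleftrightarrow> (\<exists>c\<ge>1. \<forall>\<^sub>F r in at_right 0. f (2 * r) \<le> c * f r)"

text \<open>Weak monotonicity on some interval \<open>(0, r\<^sub>0)\<close>: \<open>g r\<close> increases as \<open>r\<close> decreases to \<open>0\<close>.\<close>

definition increasing_towards_0 :: "(real \<Rightarrow> real) \<Rightarrow> bool" where
  "increasing_towards_0 g \<longleftrightarrow> (\<exists>r\<^sub>0>0. antimono_on {0<..<r\<^sub>0} g)"


section \<open>Homogeneous self-similar sets and the shift map\<close>

definition ifs_map :: "real \<Rightarrow> (nat \<Rightarrow> real) \<Rightarrow> nat \<Rightarrow> real \<Rightarrow> real" where
  "ifs_map \<rho> a j x = \<rho> * x + a j"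

definition is_attractor :: "real \<Rightarrow> (nat \<Rightarrow> real) \<Rightarrow> nat \<Rightarrow> real set \<Rightarrow> bool" where
  "is_attractor \<rho> a L K \<longleftrightarrow>
     K \<noteq> {} \<and> compact K \<and> K \<subseteq> {0..1} \<and> K = (\<Union>j\<in>{1..L}. ifs_map \<rho> a j ` K)"

definition strong_separation :: "real \<Rightarrow> (nat \<Rightarrow> real) \<Rightarrow> nat \<Rightarrow> real set \<Rightarrow> bool" where
  "strong_separation \<rho> a L K \<longleftrightarrow> disjoint_family_on (\<lambda>j. ifs_map \<rho> a j ` K) {1..L}"

text \<open>
  A sequence \<open>\<epsilon>\<^sub>1, \<epsilon>\<^sub>2, \<dots>\<close> of digits is represented by \<open>\<epsilon> :: nat \<Rightarrow> nat\<close> with \<open>\<epsilon> i\<close> standing for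
  \<open>\<epsilon>\<^bsub>i+1\<^esub>\<close>; thus \<open>ifs_comp \<rho> a \<epsilon> n\<close> is the composition of the maps for \<open>\<epsilon>\<^sub>1, \<dots>, \<epsilon>\<^sub>n\<close>, the last
  one being applied first.
\<close>

primrec ifs_comp :: "real \<Rightarrow> (nat \<Rightarrow> real) \<Rightarrow> (nat \<Rightarrow> nat) \<Rightarrow> nat \<Rightarrow> real \<Rightarrow> real" where
  "ifs_comp \<rho> a \<epsilon> 0 = id"
| "ifs_comp \<rho> a \<epsilon> (Suc n) = ifs_comp \<rho> a \<epsilon> n \<circ> ifs_map \<rho> a (\<epsilon> n)"

definition coding_map :: "real \<Rightarrow> (nat \<Rightarrow> real) \<Rightarrow> (nat \<Rightarrow> nat) \<Rightarrow> real" where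
  "coding_map \<rho> a \<epsilon> = (THE x. x \<in> (\<Inter>n\<in>{1..}. ifs_comp \<rho> a \<epsilon> n ` {0..1}))"

definition coding :: "real \<Rightarrow> (nat \<Rightarrow> real) \<Rightarrow> nat \<Rightarrow> real \<Rightarrow> nat \<Rightarrow> nat" where
  "coding \<rho> a L x = (THE \<epsilon>. \<epsilon> \<in> UNIV \<rightarrow> {1..L} \<and> coding_map \<rho> a \<epsilon> = x)"

definition shift_map :: "real \<Rightarrow> (nat \<Rightarrow> real) \<Rightarrow> nat \<Rightarrow> real \<Rightarrow> real" where
  "shift_map \<rho> a L x = coding_map \<rho> a (\<lambda>i. coding \<rho> a L x (Suc i))"

definition recurrent_set ::
  "real \<Rightarrow> (nat \<Rightarrow> real) \<Rightarrow> nat \<Rightarrow> real set \<Rightarrow> (nat \<Rightarrow> real) \<Rightarrow> real set" where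
  "recurrent_set \<rho> a L K \<phi> =
     {x \<in> K. infinite {n. 1 \<le> n \<and> \<bar>(shift_map \<rho> a L ^^ n) x - x\<bar> < \<phi> n}}"

end

theory Submission
  imports Defs "HOL-Library.Sublist"
begin

text \<open>
  Points of \<open>K\<close> are coded by digit sequences \<open>\<omega>\<close>, and a cylinder of level \<open>m\<close> (fixed first \<open>m\<close> digits)
  has diameter at most \<open>\<rho> ^ m\<close>; there are \<open>L ^ m\<close> of them, which is \<open>\<rho> powr (- \<gamma> * m)\<close>.

  \<^emph>\<open>Convergence.\<close> On the cylinder of a word \<open>w\<close> of length \<open>n\<close>, with \<open>p\<close> the fixed point of the composed map of
  \<open>w\<close>, the condition \<open>\<bar>T\<^sup>n x - x\<bar> < \<phi> n\<close> reads \<open>\<bar>x - p\<bar> < \<rho> ^ n * \<phi> n / (1 - \<rho> ^ n)\<close>. So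
  \<open>L ^ n\<close> balls of radius comparable to \<open>\<rho> ^ n * \<phi> n\<close> cover the \<open>n\<close>-th set, and the series is the cost of the tail of the limsup
  (\<open>measure_recurrent_set_null\<close>).

  \<^emph>\<open>Divergence.\<close> It suffices to catch the sequences with \<open>\<omega> (n + i) = \<omega> i\<close> for all \<open>i < l n\<close>, infinitely
  often, where \<open>\<rho> ^ l n < \<phi> n\<close>. Let \<open>E n\<close> be the set given by the \<open>n\<close>-th condition, \<open>F m = f (\<rho> ^ m)\<close> the
  cost of a cylinder of level \<open>m\<close>, and \<open>g m = F m * L ^ m\<close>, which is non-decreasing for large \<open>m\<close>. After
  lengthening \<open>l n\<close> so that \<open>F (n + l n) * L ^ n \<le> 1\<close>, the sum of these numbers still diverges
  (\<open>truncated_recurrence_lengths\<close>).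

  The probabilistic input concerns the uniform measure: if \<open>1 / L ^ t n\<close> is not summable, almost every sequence
  recurs with lengths \<open>t n\<close>. For \<open>n < m\<close> the two recurrences are independent up to an error that,
  summed over \<open>n\<close>, is at most a constant times the probability of the \<open>m\<close>-th (\<open>card_recurs_pair\<close>), so
  Chebyshev's inequality applies (\<open>almost_all_words_recur\<close>). Everything is a count of words of one length.

  If \<open>g\<close> is bounded, then \<open>1 / L ^ l n\<close> is not summable, and the exceptional points are covered by a small
  proportion of the cylinders of a level \<open>M\<close>, each of cost at most a constant times \<open>1 / L ^ M\<close>; so they
  form a null set (\<open>measure_recurrent_set_full\<close>).

  If \<open>g\<close> is unbounded, the measure of the recurrent set is infinite. This is a mass transference argument,
  carried out as a descent instead of a construction of a measure. A cover of finite cost consists, up to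
  constants, of cylinders. Call a cylinder \<open>D\<close> undercovered if none of them contains it and those inside it
  cost less than a quarter of \<open>F\<close> at the level of \<open>D\<close>. Inside an undercovered \<open>D\<close> there is an undercovered
  cylinder of some \<open>E n\<close> with \<open>n\<close> as large as desired (\<open>undercovered_refine\<close>): enlarge each cylinder of \<open>E n\<close>
  to one whose uniform measure is comparable to its cost divided by a fixed multiple of \<open>g\<close> at the level
  of \<open>D\<close>. The enlarged cylinders have divergent total measure, hence fill any prescribed proportion of \<open>D\<close>,
  and the cylinders of the \<open>E n\<close> inside them are together so expensive that the cover cannot spoil all of them. The nested
  cylinders shrink to a recurrent point that the cover misses
  (\<open>recurrent_point_outside_cheap_cover\<close>).

  For \<open>0 < s < \<gamma>\<close> the gauge \<open>r powr s\<close> has unbounded \<open>g\<close>, so the same argument gives infinite \<open>s\<close>-dimensional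
  measure and with it the lower bound for the dimension of \<open>K\<close>.
\<close>

section \<open>Counting recurrent words\<close>

definition words :: "nat \<Rightarrow> nat \<Rightarrow> nat list set" where
  "words L n = {u. set u \<subseteq> {1..L} \<and> length u = n}"

text \<open>
  For \<open>n \<ge> 1\<close> this says that the prefix of length \<open>n + t\<close> has period \<open>n\<close>.
\<close>

definition recurs :: "nat \<Rightarrow> nat \<Rightarrow> nat list \<Rightarrow> bool" where
  "recurs n t v \<longleftrightarrow> (\<forall>i<t. v ! (n + i) = v ! i)"

lemma finite_words [simp, intro]: "finite (words L n)"
  unfolding words_def by (rule finite_lists_length_eq) simp

lemma card_words: "card (words L n) = L ^ n"
  unfolding words_def by (subst card_lists_length_eq) auto

lemma words_length: "u \<in> words L n \<Longrightarrow> length u = n"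
  by (simp add: words_def)

lemma take_in_words: "v \<in> words L M \<Longrightarrow> n \<le> M \<Longrightarrow> take n v \<in> words L n"
  by (auto simp: words_def dest: in_set_takeD)

lemma words_nth: "v \<in> words L M \<Longrightarrow> i < M \<Longrightarrow> v ! i \<in> {1..L}"
  by (auto simp: words_def simp del: atLeastAtMost_iff)

lemma words_Suc: "words L (Suc n) = (\<lambda>(u, x). u @ [x]) ` (words L n \<times> {1..L})"
proof (intro equalityI subsetI)
  fix v assume "v \<in> words L (Suc n)"
  then have v: "length v = Suc n" "set v \<subseteq> {1..L}" by (auto simp: words_def)
  then have e: "v = butlast v @ [last v]"
    by (metis append_butlast_last_id length_0_conv nat.distinct(1))
  have "butlast v \<in> words L n" "last v \<in> {1..L}"
    using v by (auto simp: words_def dest: in_set_butlastD simp del: atLeastAtMost_iff)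
      (metis last_in_set length_0_conv nat.distinct(1) subsetD)
  then show "v \<in> (\<lambda>(u, x). u @ [x]) ` (words L n \<times> {1..L})"
    using e by (auto intro!: image_eqI[of _ _ "(butlast v, last v)"])
qed (auto simp: words_def)

text \<open>
  Read from left to right, a letter at a position in \<open>D\<close> is forced by an earlier letter and all other
  letters are free.
\<close>

lemma card_words_determined:
  assumes "\<And>i. i \<in> D \<Longrightarrow> h i < i"
  shows "card {v \<in> words L M. \<forall>i<M. i \<in> D \<longrightarrow> v ! i = v ! h i} = L ^ card ({..<M} - D)"
proof (induction M)
  case 0
  have "{v \<in> words L 0. \<forall>i<0. i \<in> D \<longrightarrow> v ! i = v ! h i} = {[]}" by (auto simp: words_def)
  then show ?case by simp
next
  case (Suc M)
  let ?A = "\<lambda>M. {v \<in> words L M. \<forall>i<M. i \<in> D \<longrightarrow> v ! i = v ! h i}"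
  have nth: "(u @ [x]) ! i = u ! i" if "u \<in> words L M" "i < M" for u x i
    using that by (simp add: nth_append words_def)
  have hM: "h i < M" if "i \<in> D" "i < M" for i
    using assms[OF that(1)] that(2) by simp
  show ?case
  proof (cases "M \<in> D")
    case True
    have h: "h M < M" using assms True by simp
    have "?A (Suc M) = (\<lambda>u. u @ [u ! h M]) ` ?A M"
    proof (intro equalityI subsetI)
      fix v assume v: "v \<in> ?A (Suc M)"
      then obtain u x where u: "v = u @ [x]" "u \<in> words L M" by (auto simp: words_Suc)
      have "x = u ! h M"
        using v True u nth[OF u(2) h] words_length[OF u(2)]
        by (auto dest!: spec[of _ M])
      moreover have "\<forall>i<M. i \<in> D \<longrightarrow> u ! i = u ! h i"
      proof (intro allI impI)
        fix i assume i: "i < M" "i \<in> D"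
        have "v ! i = v ! h i" using v i by auto
        then show "u ! i = u ! h i" using nth[OF u(2)] hM i u by auto
      qed
      ultimately show "v \<in> (\<lambda>u. u @ [u ! h M]) ` ?A M" using u by auto
    next
      fix v assume "v \<in> (\<lambda>u. u @ [u ! h M]) ` ?A M"
      then obtain u where u: "v = u @ [u ! h M]" "u \<in> words L M"
        "\<forall>i<M. i \<in> D \<longrightarrow> u ! i = u ! h i" by auto
      have "v \<in> words L (Suc M)"
        using u words_nth[OF u(2) h] by (auto simp: words_Suc)
      moreover have "v ! i = v ! h i" if i: "i < Suc M" "i \<in> D" for i
      proof (cases "i = M")
        case True
        then show ?thesis using u nth[OF u(2) h] words_length[OF u(2)] by auto
      next
        case False
        then show ?thesis using u nth[OF u(2)] hM i by auto
      qed
      ultimately show "v \<in> ?A (Suc M)" by auto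
    qed
    moreover have "inj_on (\<lambda>u. u @ [u ! h M]) (?A M)" by (auto intro!: inj_onI)
    ultimately have "card (?A (Suc M)) = card (?A M)" by (simp add: card_image)
    moreover have "{..<Suc M} - D = {..<M} - D" using True by (auto simp: less_Suc_eq)
    ultimately show ?thesis using Suc by simp
  next
    case False
    have "?A (Suc M) = (\<lambda>(u, x). u @ [x]) ` (?A M \<times> {1..L})"
    proof (intro equalityI subsetI)
      fix v assume v: "v \<in> ?A (Suc M)"
      then obtain u x where u: "v = u @ [x]" "u \<in> words L M" "x \<in> {1..L}"
        by (auto simp: words_Suc)
      have "\<forall>i<M. i \<in> D \<longrightarrow> u ! i = u ! h i"
      proof (intro allI impI)
        fix i assume i: "i < M" "i \<in> D"
        have "v ! i = v ! h i" using v i by auto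
        then show "u ! i = u ! h i" using nth[OF u(2)] hM i u by auto
      qed
      then show "v \<in> (\<lambda>(u, x). u @ [x]) ` (?A M \<times> {1..L})" using u by auto
    next
      fix v assume "v \<in> (\<lambda>(u, x). u @ [x]) ` (?A M \<times> {1..L})"
      then obtain u x where u: "v = u @ [x]" "u \<in> words L M" "x \<in> {1..L}"
        "\<forall>i<M. i \<in> D \<longrightarrow> u ! i = u ! h i" by auto
      have "v \<in> words L (Suc M)" using u by (auto simp: words_Suc)
      moreover have "v ! i = v ! h i" if i: "i < Suc M" "i \<in> D" for i
      proof -
        have "i < M" using i False by (cases "i = M") auto
        then show ?thesis using u nth[OF u(2)] hM i by auto
      qed
      ultimately show "v \<in> ?A (Suc M)" by auto
    qed
    moreover have "inj_on (\<lambda>(u, x). u @ [x]) (?A M \<times> {1..L})" by (auto intro!: inj_onI)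
    ultimately have "card (?A (Suc M)) = card (?A M) * L"
      by (simp add: card_image card_cartesian_product)
    moreover have "{..<Suc M} - D = insert M ({..<M} - D)" using False by auto
    ultimately show ?thesis using Suc by simp
  qed
qed

lemma card_words_determined_le:
  assumes L: "L \<ge> 1" and A: "A \<subseteq> words L M"
    and D: "D \<subseteq> {..<M}" "k \<le> card D"
    and h: "\<And>i. i \<in> D \<Longrightarrow> h i < i" "\<And>v i. v \<in> A \<Longrightarrow> i \<in> D \<Longrightarrow> v ! i = v ! h i"
  shows "real (card A) \<le> real L ^ M / real L ^ k"
proof -
  have fD: "finite D" using D finite_subset by blast
  have "card A \<le> card {v \<in> words L M. \<forall>i<M. i \<in> D \<longrightarrow> v ! i = v ! h i}"
    using A h(2) by (intro card_mono) auto
  also have "\<dots> = L ^ card ({..<M} - D)" by (rule card_words_determined) (rule h(1))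
  also have "card ({..<M} - D) = M - card D" using D by (simp add: card_Diff_subset fD)
  also have "L ^ (M - card D) \<le> L ^ (M - k)" using L D by (intro power_increasing) auto
  finally have "real (card A) \<le> real L ^ (M - k)" by (metis of_nat_le_iff of_nat_power)
  moreover have "k \<le> M" using D card_mono[of "{..<M}" D] by auto
  ultimately show ?thesis using L by (simp add: power_diff)
qed

lemma card_recurs:
  assumes L: "L \<ge> 1" and n: "n \<ge> 1" "n + t \<le> M"
  shows "real (card {v \<in> words L M. recurs n t v}) = real L ^ M / real L ^ t"
proof -
  let ?D = "{n..<n+t}"
  have "{v \<in> words L M. recurs n t v} =
      {v \<in> words L M. \<forall>i<M. i \<in> ?D \<longrightarrow> v ! i = v ! (i - n)}" (is "?A = ?B")
  proof -
    have "recurs n t v \<longleftrightarrow> (\<forall>i<M. i \<in> ?D \<longrightarrow> v ! i = v ! (i - n))" for v :: "nat list"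
    proof
      assume r: "recurs n t v"
      show "\<forall>i<M. i \<in> ?D \<longrightarrow> v ! i = v ! (i - n)"
      proof (intro allI impI)
        fix i assume "i \<in> ?D"
        then have "i - n < t" "n + (i - n) = i" by auto
        then show "v ! i = v ! (i - n)" using r unfolding recurs_def by metis
      qed
    next
      assume r: "\<forall>i<M. i \<in> ?D \<longrightarrow> v ! i = v ! (i - n)"
      show "recurs n t v" unfolding recurs_def
      proof (intro allI impI)
        fix i assume "i < t"
        then show "v ! (n + i) = v ! i" using r[rule_format, of "n + i"] n by auto
      qed
    qed
    then show ?thesis by auto
  qed
  also have "card ?B = L ^ card ({..<M} - ?D)"
    by (rule card_words_determined) (use n in auto)
  also have "card ({..<M} - ?D) = M - t"
    using n by (subst card_Diff_subset) auto
  finally have "real (card {v \<in> words L M. recurs n t v}) = real L ^ (M - t)" by simp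
  also have "\<dots> = real L ^ M / real L ^ t" using L n by (intro power_diff) auto
  finally show ?thesis .
qed

lemma recurs_nth: "recurs n t v \<Longrightarrow> n \<le> i \<Longrightarrow> i < n + t \<Longrightarrow> v ! i = v ! (i - n)"
  unfolding recurs_def by (metis add_diff_inverse_nat add_less_cancel_left not_less)

text \<open>
  The recurrences force the positions \<open>{n..<n+a}\<close> and \<open>{m..<m+c}\<close>. If these ranges are disjoint, or can be
  made so, the two recurrences are independent, which is the first summand. If the second range overlaps the
  first and sticks out of it, all of \<open>{n..<m+c}\<close> is forced. If it is contained in the first, shifting by \<open>n\<close> turns the
  second recurrence into period \<open>m - n\<close> of the prefix of length \<open>m - n + c\<close>; this forces \<open>c\<close> further
  positions below \<open>n\<close>, or else all of \<open>{m-n..<n}\<close>, and then at least \<open>c + n\<close> positions are forced in total.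
  Summed over \<open>n < m\<close>, the error terms stay below a constant multiple of \<open>1 / L ^ c\<close>.
\<close>

lemma card_recurs_pair:
  assumes L: "L \<ge> 1" and n: "1 \<le> n" "n < m" "n + a \<le> M" "m + c \<le> M"
  shows "real (card {v \<in> words L M. recurs n a v \<and> recurs m c v}) \<le>
    real L ^ M * (1 / L ^ a * (1 / L ^ c) + 1 / L ^ c * (1 / L ^ (m - n) + 1 / L ^ n))"
    (is "real (card ?A) \<le> _ * (?x + ?y * (?z + ?w))")
proof -
  have sub: "?A \<subseteq> words L M" by auto
  have nn: "0 \<le> ?x" "0 \<le> ?y * ?z" "0 \<le> ?y * ?w" by auto
  have "\<exists>k. real (card ?A) \<le> real L ^ M / real L ^ k \<and>
      (k = a + c \<or> k = c + (m - n) \<or> k = c + n)"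
  proof -
    consider (indep) "n + a \<le> m" | (long) "m < n + a" "n + a < m + c"
      | (short) "m < n + a" "m + c \<le> n + a" "(m - n) + c \<le> n"
      | (per) "m < n + a" "m + c \<le> n + a" "n < (m - n) + c" by linarith
    then show ?thesis
    proof cases
      case indep
      have "real (card ?A) \<le> real L ^ M / real L ^ (a + c)"
      proof (rule card_words_determined_le[OF L sub,
            where D = "{n..<n+a} \<union> {m..<m+c}" and h = "\<lambda>i. if i < n + a then i - n else i - m"])
        show "a + c \<le> card ({n..<n + a} \<union> {m..<m + c})"
          using indep by (subst card_Un_disjoint) auto
      qed (use n indep in \<open>auto dest: recurs_nth\<close>)
      then show ?thesis by blast
    next
      case long
      have "real (card ?A) \<le> real L ^ M / real L ^ (c + (m - n))"
      proof (rule card_words_determined_le[OF L sub,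
            where D = "{n..<m+c}" and h = "\<lambda>i. if i < n + a then i - n else i - m"])
        show "v ! i = v ! (if i < n + a then i - n else i - m)"
          if "v \<in> ?A" "i \<in> {n..<m+c}" for v i
          using that recurs_nth[of n a v i] recurs_nth[of m c v i] long by auto
      qed (use n long in auto)
      then show ?thesis by blast
    next
      case short
      have E: "v ! j = v ! (j - (m - n))" if "v \<in> ?A" "m - n \<le> j" "j < m - n + c" for v j
      proof -
        have "v ! (j + n) = v ! j" using that short n recurs_nth[of n a v "j + n"] by auto
        moreover have "v ! (j + n) = v ! (j + n - m)" 
          using that short n recurs_nth[of m c v "j + n"] by auto
        moreover have "j + n - m = j - (m - n)" using n by auto
        ultimately show ?thesis by metis
      qed
      have "real (card ?A) \<le> real L ^ M / real L ^ (a + c)"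
      proof (rule card_words_determined_le[OF L sub,
            where D = "{n..<n+a} \<union> {m-n..<m-n+c}" and h = "\<lambda>i. if i < n then i - (m-n) else i - n"])
        show "a + c \<le> card ({n..<n + a} \<union> {m-n..<m-n + c})"
          using short by (subst card_Un_disjoint) auto
        show "v ! i = v ! (if i < n then i - (m-n) else i - n)"
          if "v \<in> ?A" "i \<in> {n..<n+a} \<union> {m-n..<m-n+c}" for v i
          using that E[of v i] recurs_nth[of n a v i] short by auto
      qed (use n short in auto)
      then show ?thesis by blast
    next
      case per
      have E: "v ! j = v ! (j - (m - n))" if "v \<in> ?A" "m - n \<le> j" "j < m - n + c" for v j
      proof -
        have "v ! (j + n) = v ! j" using that per n recurs_nth[of n a v "j + n"] by auto
        moreover have "v ! (j + n) = v ! (j + n - m)" 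
          using that per n recurs_nth[of m c v "j + n"] by auto
        moreover have "j + n - m = j - (m - n)" using n by auto
        ultimately show ?thesis by metis
      qed
      have "real (card ?A) \<le> real L ^ M / real L ^ (c + n)"
      proof (rule card_words_determined_le[OF L sub,
            where D = "{n..<n+a} \<union> {m-n..<n}" and h = "\<lambda>i. if i < n then i - (m-n) else i - n"])
        show "c + n \<le> card ({n..<n + a} \<union> {m-n..<n})"
          using per n by (subst card_Un_disjoint) auto
        show "v ! i = v ! (if i < n then i - (m-n) else i - n)"
          if "v \<in> ?A" "i \<in> {n..<n+a} \<union> {m-n..<n}" for v i
          using that E[of v i] recurs_nth[of n a v i] per by auto
      qed (use n per in auto)
      then show ?thesis by blast
    qed
  qed
  then obtain k where k: "real (card ?A) \<le> real L ^ M * (1 / real L ^ k)"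
      "k = a + c \<or> k = c + (m - n) \<or> k = c + n" by auto
  have "1 / real L ^ k \<le> ?x + ?y * (?z + ?w)"
  proof -
    have "1 / real L ^ k = ?x \<or> 1 / real L ^ k = ?y * ?z \<or> 1 / real L ^ k = ?y * ?w"
      using k(2) by (auto simp: power_add)
    moreover have "e \<le> x + (y + z)" if "0 \<le> x" "0 \<le> y" "0 \<le> z" "e = x \<or> e = y \<or> e = z" for e x y z :: real
      using that by linarith
    ultimately show ?thesis using nn unfolding distrib_left by blast
  qed
  then have "real L ^ M * (1 / real L ^ k) \<le> real L ^ M * (?x + ?y * (?z + ?w))"
    by (intro mult_left_mono) auto
  with k(1) show ?thesis by (rule order_trans)
qed

lemma sum_inverse_powers_le:
  assumes "L \<ge> 2"
  shows "(\<Sum>i\<in>{1..m}. 1 / real L ^ i) \<le> 1"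
proof -
  have "(\<Sum>i\<in>{1..m}. 1 / real L ^ i) \<le> (\<Sum>i\<in>{1..m}. (1/2) ^ i)"
    using assms by (intro sum_mono) (auto simp: power_one_over intro!: divide_left_mono power_mono)
  also have "\<dots> = 1 - (1/2)^m" by (induction m) auto
  also have "\<dots> \<le> 1" by simp
  finally show ?thesis .
qed

text \<open>
  Off the diagonal, the error terms of \<open>card_recurs_pair\<close> add at most \<open>2 * (2 * S)\<close> to the product
  terms, because both geometric sums over \<open>n < m\<close> are at most \<open>1\<close>. The diagonal adds \<open>S\<close>.
\<close>

lemma second_moment_recurs:
  fixes t :: "nat \<Rightarrow> nat"
  assumes L: "L \<ge> 2" and k: "k \<ge> 1" and M: "\<And>n. n \<in> {k..N} \<Longrightarrow> n + t n \<le> M"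
    and S: "S = (\<Sum>n\<in>{k..N}. 1 / real L ^ t n)"
  shows "(\<Sum>v\<in>words L M. (\<Sum>n\<in>{k..N}. of_bool (recurs n (t n) v))\<^sup>2) \<le> real L ^ M * (S\<^sup>2 + 5 * S)"
proof -
  let ?I = "{k..N}"
  let ?p = "\<lambda>n. 1 / real L ^ t n"
  let ?c = "\<lambda>n m. 1 / real L ^ (m - n) + 1 / real L ^ n"
  have p0: "?p n \<ge> 0" for n by simp
  have split: "real (card {v \<in> words L M. recurs n (t n) v \<and> recurs m (t m) v}) \<le>
     real L ^ M * (?p n * ?p m + (if n = m then ?p n else 0) +
       ((if n < m then ?p m * ?c n m else 0) + (if m < n then ?p n * ?c m n else 0)))"
    if nm: "n \<in> ?I" "m \<in> ?I" for n m
  proof -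
    consider "n = m" | "n < m" | "m < n" by linarith
    then show ?thesis
    proof cases
      case 1
      then have "real (card {v \<in> words L M. recurs n (t n) v \<and> recurs m (t m) v}) = real L ^ M * ?p n"
        using card_recurs[of L n "t n" M] L k M nm by simp
      also have "\<dots> \<le> real L ^ M * (?p n * ?p m + ?p n)"
        by (intro mult_left_mono) auto
      finally show ?thesis using 1 by simp
    next
      case 2
      then show ?thesis using card_recurs_pair[of L n m "t n" M "t m"] L k M nm by simp
    next
      case 3
      have e: "{v \<in> words L M. recurs n (t n) v \<and> recurs m (t m) v} =
          {v \<in> words L M. recurs m (t m) v \<and> recurs n (t n) v}" by auto
      show ?thesis unfolding e
        using 3 card_recurs_pair[of L m n "t m" M "t n"] L k M nm by (simp add: mult.commute)
    qed
  qed
  have c2: "(\<Sum>n\<in>?I. if n < m then ?c n m else 0) \<le> 2" for m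
  proof -
    have "(\<Sum>n\<in>?I. if n < m then ?c n m else 0) \<le> (\<Sum>n\<in>{1..m}. if n < m then ?c n m else 0)"
    proof -
      have "(\<Sum>n\<in>?I. if n < m then ?c n m else 0) = (\<Sum>n\<in>?I \<inter> {..m}. if n < m then ?c n m else 0)"
        by (intro sum.mono_neutral_right) auto
      also have "\<dots> \<le> (\<Sum>n\<in>{1..m}. if n < m then ?c n m else 0)"
        using k by (intro sum_mono2) (auto intro!: add_nonneg_nonneg)
      finally show ?thesis .
    qed
    also have "\<dots> \<le> (\<Sum>n\<in>{1..<m}. ?c n m)"
      by (subst sum.mono_neutral_right[of "{1..m}" "{1..<m}"]) auto
    also have "\<dots> = (\<Sum>n\<in>{1..<m}. 1 / real L ^ (m - n)) + (\<Sum>n\<in>{1..<m}. 1 / real L ^ n)"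
      by (rule sum.distrib)
    also have "(\<Sum>n\<in>{1..<m}. 1 / real L ^ (m - n)) = (\<Sum>n\<in>{1..<m}. 1 / real L ^ n)"
      by (rule sum.reindex_bij_witness[where i = "\<lambda>n. m - n" and j = "\<lambda>n. m - n"]) auto
    also have "{1..<m} = {1..m-1}" by auto
    finally have "(\<Sum>n\<in>?I. if n < m then ?c n m else 0) \<le>
      (\<Sum>n\<in>{1..m-1}. 1 / real L ^ n) + (\<Sum>n\<in>{1..m-1}. 1 / real L ^ n)" .
    also have "\<dots> \<le> 1 + 1" by (intro add_mono sum_inverse_powers_le[OF L])
    finally show ?thesis by simp
  qed
  have "(\<Sum>v\<in>words L M. (\<Sum>n\<in>?I. of_bool (recurs n (t n) v) :: real)\<^sup>2) =
     (\<Sum>v\<in>words L M. \<Sum>n\<in>?I. \<Sum>m\<in>?I. of_bool (recurs n (t n) v \<and> recurs m (t m) v))"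
    by (simp only: power2_eq_square sum_product of_bool_conj)
  also have "\<dots> = (\<Sum>n\<in>?I. \<Sum>v\<in>words L M. \<Sum>m\<in>?I. of_bool (recurs n (t n) v \<and> recurs m (t m) v))"
    by (rule sum.swap)
  also have "\<dots> = (\<Sum>n\<in>?I. \<Sum>m\<in>?I. \<Sum>v\<in>words L M. of_bool (recurs n (t n) v \<and> recurs m (t m) v))"
    by (intro sum.cong refl sum.swap)
  also have "\<dots> = (\<Sum>n\<in>?I. \<Sum>m\<in>?I. real (card {v \<in> words L M. recurs n (t n) v \<and> recurs m (t m) v}))"
    by (intro sum.cong refl) (simp add: sum.If_cases of_bool_def Int_def)
  also have "\<dots> \<le> (\<Sum>n\<in>?I. \<Sum>m\<in>?I. real L ^ M * (?p n * ?p m + (if n = m then ?p n else 0) +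
       ((if n < m then ?p m * ?c n m else 0) + (if m < n then ?p n * ?c m n else 0))))"
    by (intro sum_mono split)
  also have "\<dots> = real L ^ M * ((\<Sum>n\<in>?I. \<Sum>m\<in>?I. ?p n * ?p m) + (\<Sum>n\<in>?I. \<Sum>m\<in>?I. if n = m then ?p n else 0) +
       ((\<Sum>n\<in>?I. \<Sum>m\<in>?I. if n < m then ?p m * ?c n m else 0) +
        (\<Sum>n\<in>?I. \<Sum>m\<in>?I. if m < n then ?p n * ?c m n else 0)))"
    by (simp only: sum_distrib_left sum.distrib distrib_left)
  also have "(\<Sum>n\<in>?I. \<Sum>m\<in>?I. ?p n * ?p m) = S\<^sup>2"
    by (simp only: S power2_eq_square sum_product)
  also have "(\<Sum>n\<in>?I. \<Sum>m\<in>?I. if n = m then ?p n else 0) = S"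
    by (simp add: S)
  also have "(\<Sum>n\<in>?I. \<Sum>m\<in>?I. if n < m then ?p m * ?c n m else 0) =
      (\<Sum>n\<in>?I. \<Sum>m\<in>?I. if m < n then ?p n * ?c m n else 0)"
    by (rule sum.swap)
  also have "(\<Sum>n\<in>?I. \<Sum>m\<in>?I. if m < n then ?p n * ?c m n else 0) =
      (\<Sum>n\<in>?I. ?p n * (\<Sum>m\<in>?I. if m < n then ?c m n else 0))" (is "_ = ?C")
    unfolding sum_distrib_left by (intro sum.cong refl) (simp split: if_split)
  finally have *: "(\<Sum>v\<in>words L M. (\<Sum>n\<in>?I. of_bool (recurs n (t n) v) :: real)\<^sup>2) \<le>
     real L ^ M * (S\<^sup>2 + S + (?C + ?C))" .
  have "?C \<le> (\<Sum>n\<in>?I. ?p n * 2)"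
    by (intro sum_mono mult_left_mono c2 p0)
  also have "\<dots> = 2 * S" by (simp only: S sum_distrib_left mult.commute)
  finally have "?C \<le> 2 * S" .
  moreover have "x + S + (C + C) \<le> x + 5 * S" if "C \<le> 2 * S" for x C :: real using that by simp
  ultimately have "S\<^sup>2 + S + (?C + ?C) \<le> S\<^sup>2 + 5 * S" by blast
  then have "real L ^ M * (S\<^sup>2 + S + (?C + ?C)) \<le> real L ^ M * (S\<^sup>2 + 5 * S)"
    by (intro mult_left_mono) auto
  with * show ?thesis by (rule order_trans)
qed

text \<open>
  Chebyshev's inequality: the number of recurrences has mean \<open>S\<close> and variance at most \<open>5 * S\<close>.
\<close>

lemma card_never_recurs_le:
  fixes t :: "nat \<Rightarrow> nat"
  assumes L: "L \<ge> 2" and k: "k \<ge> 1" and M: "\<And>n. n \<in> {k..N} \<Longrightarrow> n + t n \<le> M"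
    and S: "S = (\<Sum>n\<in>{k..N}. 1 / real L ^ t n)" "S > 0"
  shows "real (card {v \<in> words L M. \<forall>n\<in>{k..N}. \<not> recurs n (t n) v}) \<le> 5 / S * real L ^ M"
proof -
  let ?I = "{k..N}" and ?Z = "{v \<in> words L M. \<forall>n\<in>{k..N}. \<not> recurs n (t n) v}"
  let ?X = "\<lambda>v. (\<Sum>n\<in>?I. of_bool (recurs n (t n) v) :: real)"
  have mean: "(\<Sum>v\<in>words L M. ?X v) = real L ^ M * S"
  proof -
    have "(\<Sum>v\<in>words L M. ?X v) = (\<Sum>n\<in>?I. \<Sum>v\<in>words L M. of_bool (recurs n (t n) v))"
      by (rule sum.swap)
    also have "\<dots> = (\<Sum>n\<in>?I. real (card {v \<in> words L M. recurs n (t n) v}))"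
      by (intro sum.cong refl) (simp add: sum.If_cases of_bool_def Int_def)
    also have "\<dots> = (\<Sum>n\<in>?I. real L ^ M * (1 / real L ^ t n))"
      using L k M by (intro sum.cong refl) (subst card_recurs, auto)
    finally show ?thesis by (simp only: S sum_distrib_left)
  qed
  have "real (card ?Z) * S\<^sup>2 = (\<Sum>v\<in>?Z. (?X v - S)\<^sup>2)" by simp
  also have "\<dots> \<le> (\<Sum>v\<in>words L M. (?X v - S)\<^sup>2)" by (intro sum_mono2) auto
  also have "\<dots> = (\<Sum>v\<in>words L M. (?X v)\<^sup>2) - 2 * S * (\<Sum>v\<in>words L M. ?X v) + real L ^ M * S\<^sup>2"
    unfolding power2_diff sum.distrib sum_subtractf sum_distrib_left[symmetric]
    by (simp only: sum_distrib_left sum_constant card_words of_nat_power mult_ac)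
  also have "\<dots> \<le> real L ^ M * (S\<^sup>2 + 5 * S) - 2 * S * (real L ^ M * S) + real L ^ M * S\<^sup>2"
    unfolding mean using second_moment_recurs[OF L k M S(1)] by simp
  also have "\<dots> = 5 * S * real L ^ M" by (simp add: algebra_simps power2_eq_square)
  finally have "real (card ?Z) * S * S \<le> 5 * real L ^ M * S" 
    by (simp add: power2_eq_square algebra_simps)
  then have "real (card ?Z) * S \<le> 5 * real L ^ M" using S(2) by simp
  then show ?thesis using S(2) by (simp add: field_simps)
qed

text \<open>
  The divergent half of the Borel--Cantelli lemma for recurrences under the uniform measure, in finite form.
\<close>

lemma almost_all_words_recur:
  fixes t :: "nat \<Rightarrow> nat"
  assumes L: "L \<ge> 2" and div: "\<not> summable (\<lambda>n. 1 / real L ^ t n)" and d: "\<delta> > 0" and k: "k \<ge> 1"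
  obtains N where "\<And>M. (\<And>n. n \<in> {k..N} \<Longrightarrow> n + t n \<le> M) \<Longrightarrow>
    real (card {v \<in> words L M. \<forall>n\<in>{k..N}. \<not> recurs n (t n) v}) \<le> \<delta> * real L ^ M"
proof -
  let ?p = "\<lambda>n. 1 / real L ^ t n"
  have "\<not> bdd_above (range (\<lambda>N. \<Sum>n<N. ?p n))"
    using div summableI_nonneg_bounded[of ?p] by (force simp: bdd_above_def)
  then obtain N where N: "(\<Sum>n<N. ?p n) > (\<Sum>n<k. ?p n) + 5 / \<delta>"
    by (force simp: bdd_above_def not_le)
  have "(\<Sum>n<N. ?p n) \<le> (\<Sum>n\<in>{..<k} \<union> {k..N}. ?p n)" by (intro sum_mono2) auto
  also have "\<dots> = (\<Sum>n<k. ?p n) + (\<Sum>n\<in>{k..N}. ?p n)" by (intro sum.union_disjoint) auto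
  finally have S: "(\<Sum>n\<in>{k..N}. ?p n) > 5 / \<delta>" using N by linarith
  moreover have "5 / \<delta> > 0" using d by simp
  ultimately have S0: "(\<Sum>n\<in>{k..N}. ?p n) > 0" by linarith
  have "5 / (\<Sum>n\<in>{k..N}. ?p n) \<le> \<delta>" using S S0 d by (simp add: field_simps)
  then have *: "5 / (\<Sum>n\<in>{k..N}. ?p n) * real L ^ M \<le> \<delta> * real L ^ M" for M
    by (intro mult_right_mono) auto
  show thesis
  proof (rule that)
    fix M assume "\<And>n. n \<in> {k..N} \<Longrightarrow> n + t n \<le> M"
    from card_never_recurs_le[OF L k this refl S0] *[of M]
    show "real (card {v \<in> words L M. \<forall>n\<in>{k..N}. \<not> recurs n (t n) v}) \<le> \<delta> * real L ^ M"
      by (rule order_trans)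
  qed
qed

section \<open>Cylinders in the uniform measure\<close>

text \<open>
  The mass of the cylinder of \<open>u\<close> under the uniform Bernoulli measure on digit sequences.
\<close>

definition weight :: "nat \<Rightarrow> nat list \<Rightarrow> real" where
  "weight L u = 1 / real L ^ length u"

lemma weight_nonneg [simp]: "0 \<le> weight L u"
  by (simp add: weight_def)

lemma card_extensions:
  assumes L: "L \<ge> 1" and u: "u \<in> words L (length u)" "length u \<le> M"
  shows "real (card {v \<in> words L M. prefix u v}) = real L ^ M * weight L u"
proof -
  have "{v \<in> words L M. prefix u v} = (\<lambda>w. u @ w) ` words L (M - length u)"
    using u by (auto simp: words_def prefix_def simp del: atLeastAtMost_iff)
  then have "card {v \<in> words L M. prefix u v} = L ^ (M - length u)"
    by (simp add: card_image card_words inj_on_def)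
  then have "real (card {v \<in> words L M. prefix u v}) = real L ^ (M - length u)" by simp
  also have "\<dots> = real L ^ M / real L ^ length u" using u L by (intro power_diff) auto
  finally show ?thesis by (simp add: weight_def)
qed

text \<open>
  Kraft's inequality below \<open>c\<close>: the sets of extensions of the members of a prefix antichain are disjoint.
\<close>

lemma antichain_weight_le:
  assumes L: "L \<ge> 1" and B: "finite B" "\<And>u. u \<in> B \<Longrightarrow> u \<in> words L (length u)"
    and anti: "\<And>u u'. u \<in> B \<Longrightarrow> u' \<in> B \<Longrightarrow> prefix u u' \<Longrightarrow> u = u'"
    and c: "c \<in> words L (length c)" "\<And>u. u \<in> B \<Longrightarrow> prefix c u"
  shows "(\<Sum>u\<in>B. weight L u) \<le> weight L c"
proof -
  define M where "M = length c + (\<Sum>u\<in>B. length u)"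
  have M: "length u \<le> M" if "u \<in> B" for u
    using member_le_sum[of u B length] that B(1) by (simp add: M_def)
  let ?E = "\<lambda>u. {v \<in> words L M. prefix u v}"
  have "real L ^ M * (\<Sum>u\<in>B. weight L u) = (\<Sum>u\<in>B. real (card (?E u)))"
    unfolding sum_distrib_left using L B(2) M by (intro sum.cong refl card_extensions[symmetric]) auto
  also have "\<dots> = real (card (\<Union>u\<in>B. ?E u))"
  proof (subst card_UN_disjoint)
    show "\<forall>i\<in>B. \<forall>j\<in>B. i \<noteq> j \<longrightarrow> ?E i \<inter> ?E j = {}"
      using anti prefix_same_cases by blast
  qed (use B in auto)
  also have "\<dots> \<le> real (card (?E c))"
    using c(2) by (intro of_nat_mono card_mono) (auto intro: prefix_order.trans)
  also have "\<dots> = real L ^ M * weight L c"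
    using L c by (intro card_extensions) (auto simp: M_def)
  finally show ?thesis using L by (subst (asm) mult_le_cancel_left_pos) auto
qed

lemma card_covered_words_le:
  assumes L: "L \<ge> 1" and B: "finite B" "\<And>u. u \<in> B \<Longrightarrow> u \<in> words L (length u) \<and> length u \<le> M"
    and V: "V \<subseteq> words L M" "\<And>v. v \<in> V \<Longrightarrow> \<exists>u\<in>B. prefix u v"
  shows "real (card V) \<le> real L ^ M * (\<Sum>u\<in>B. weight L u)"
proof -
  let ?E = "\<lambda>u. {v \<in> words L M. prefix u v}"
  have "card V \<le> card (\<Union>u\<in>B. ?E u)" using V B(1) by (intro card_mono) auto
  also have "\<dots> \<le> (\<Sum>u\<in>B. card (?E u))" by (rule card_UN_le[OF B(1)])
  finally have "real (card V) \<le> (\<Sum>u\<in>B. real (card (?E u)))" by (simp flip: of_nat_sum)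
  also have "\<dots> = real L ^ M * (\<Sum>u\<in>B. weight L u)"
    unfolding sum_distrib_left using L B(2) by (intro sum.cong refl card_extensions) auto
  finally show ?thesis .
qed

lemma recurs_prefix:
  assumes "prefix u v" "n + t \<le> length u"
  shows "recurs n t u \<longleftrightarrow> recurs n t v"
proof -
  obtain w where w: "v = u @ w" using assms by (auto simp: prefix_def)
  have "v ! i = u ! i" if "i < n + t" for i
    using that assms(2) unfolding w by (simp add: nth_append)
  then show ?thesis unfolding recurs_def by simp
qed

lemma periodic_extension:
  assumes "t \<le> l" "n \<ge> 1" "u \<in> words L (n + t)" "recurs n t u"
  shows "\<exists>v. v \<in> words L (n + l) \<and> recurs n l v \<and> prefix u v"
  using assms(1)
proof (induction l rule: dec_induct)
  case base
  then show ?case using assms by auto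
next
  case (step l)
  then obtain v where v: "v \<in> words L (n + l)" "recurs n l v" "prefix u v" by blast
  have len: "length v = n + l" using v(1) by (rule words_length)
  let ?w = "v @ [v ! l]"
  have "v ! l \<in> {1..L}" using v(1) assms(2) by (intro words_nth[of v L "n + l"]) auto
  then have "?w \<in> words L (n + Suc l)" using v(1) by (auto simp: words_Suc)
  moreover have "recurs n (Suc l) ?w"
    using v(2) len assms(2) by (auto simp: recurs_def nth_append less_Suc_eq)
  moreover have "prefix u ?w" using v(3) by auto
  ultimately show ?case by blast
qed

lemma sum_infsum_le_infsum:
  fixes f :: "'a \<Rightarrow> real"
  assumes "finite J" "f summable_on A" "\<And>x. x \<in> A \<Longrightarrow> f x \<ge> 0"
    and "\<And>j. j \<in> J \<Longrightarrow> B j \<subseteq> A" "\<And>i j. i \<in> J \<Longrightarrow> j \<in> J \<Longrightarrow> i \<noteq> j \<Longrightarrow> B i \<inter> B j = {}"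
  shows "(\<Sum>j\<in>J. infsum f (B j)) \<le> infsum f A"
proof -
  have s: "f summable_on S" if "S \<subseteq> A" for S
    using summable_on_subset_banach[OF assms(2) that] .
  have "(\<Sum>j\<in>J. infsum f (B j)) = infsum f (\<Union>j\<in>J. B j)"
    using assms s by (intro sum_infsum) auto
  also have "\<dots> \<le> infsum f A"
    using assms by (intro infsum_mono2 s) auto
  finally show ?thesis .
qed

section \<open>Recurrent sequences outside a cover by cylinders\<close>

text \<open>
  \<open>F m\<close> is the cost of a cylinder of level \<open>m\<close>, so \<open>F m * L ^ m\<close> is its cost relative to its uniform
  measure. The words of length \<open>n + l n\<close> that recur after \<open>n\<close> steps are the cylinders to be hit
  infinitely often, and \<open>F (n + l n) * L ^ n\<close> is the total cost of those with a given \<open>n\<close>.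
\<close>

locale recurrence_gauge =
  fixes L :: nat and F :: "nat \<Rightarrow> real" and l :: "nat \<Rightarrow> nat" and m1 :: nat
  assumes L: "L \<ge> 2"
    and F_pos: "F m > 0"
    and F_antimono: "m \<le> m' \<Longrightarrow> F m' \<le> F m"
    and g_ge1: "m1 \<le> m \<Longrightarrow> 1 \<le> F m * real L ^ m"
    and g_mono: "m1 \<le> m \<Longrightarrow> m \<le> m' \<Longrightarrow> F m * real L ^ m \<le> F m' * real L ^ m'"
    and g_unbounded: "\<exists>m\<ge>m1. x \<le> F m * real L ^ m"
    and s_le1: "n \<ge> 1 \<Longrightarrow> F (n + l n) * real L ^ n \<le> 1"
    and s_div: "\<not> summable (\<lambda>n. F (n + l n) * real L ^ n)"
begin

definition cost :: "nat list set \<Rightarrow> nat list \<Rightarrow> real" where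
  "cost C u = infsum (\<lambda>c. F (length c)) {c \<in> C. prefix u c}"

text \<open>
  The invariant of the descent. With the factor \<open>1 / 4\<close>, the members of \<open>C\<close> inside \<open>u\<close> occupy at most a
  quarter of the cylinder in the uniform measure, since from level \<open>m1\<close> on the cost of a cylinder relative to its measure
  increases with the level.
\<close>

definition undercovered :: "nat list set \<Rightarrow> nat list \<Rightarrow> bool" where
  "undercovered C u \<longleftrightarrow> (\<forall>c\<in>C. \<not> prefix c u) \<and> cost C u < F (length u) / 4"

text \<open>
  Enlarging the cylinders of level \<open>n + l n\<close> to level \<open>n + t n\<close> makes their uniform measure comparable to
  their cost divided by \<open>\<eta>\<close>, so that divergence of total cost becomes divergence of total measure. The smallest
  such \<open>t n\<close> is at most \<open>l n\<close>, because from level \<open>M'\<close> on the relative cost is at least \<open>\<eta>\<close>.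
\<close>

lemma enlarged_recurrence_lengths:
  assumes M': "M' \<ge> m1" "M' \<ge> 1" and \<eta>: "1 \<le> \<eta>" "\<eta> \<le> F M' * real L ^ M'"
  obtains t where "\<not> summable (\<lambda>n. 1 / real L ^ t n)"
    "\<And>n. n \<ge> M' \<Longrightarrow> t n \<le> l n"
    "\<And>n. n \<ge> M' \<Longrightarrow> \<eta> * (1 / real L ^ (n + t n)) \<le> F (n + l n)"
    "\<And>n. n \<ge> M' \<Longrightarrow> F (n + l n) \<le> \<eta> * real L * (1 / real L ^ (n + t n))"
proof -
  let ?s = "\<lambda>n. F (n + l n) * real L ^ n"
  have L0: "real L > 1" "real L > 0" using L by auto
  have s0: "?s n > 0" for n using F_pos L by simp
  define t where "t = (\<lambda>n. LEAST t. \<eta> \<le> ?s n * real L ^ t)"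
  have ex: "\<exists>t. \<eta> \<le> ?s n * real L ^ t" for n
  proof -
    obtain t where "\<eta> / ?s n < real L ^ t" using real_arch_pow[OF L0(1)] by blast
    then have "\<eta> \<le> ?s n * real L ^ t" using s0[of n] by (simp add: field_simps)
    then show ?thesis by blast
  qed
  have t1: "\<eta> \<le> ?s n * real L ^ t n" for n unfolding t_def by (rule LeastI_ex[OF ex])
  have t2: "?s n * real L ^ t n \<le> \<eta> * real L" if "n \<ge> M'" for n
  proof (cases "t n")
    case 0
    have "?s n * real L ^ t n \<le> 1" using 0 s_le1[of n] that M' by simp
    also have "\<dots> \<le> \<eta> * real L" using mult_mono[of 1 \<eta> 1 "real L"] \<eta> L by simp
    finally show ?thesis .
  next
    case (Suc t')
    have "\<not> \<eta> \<le> ?s n * real L ^ t'" 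
      using not_less_Least[of t' "\<lambda>t. \<eta> \<le> ?s n * real L ^ t"] Suc by (simp add: t_def)
    then have "?s n * real L ^ t' * real L \<le> \<eta> * real L" by (intro mult_right_mono) auto
    then show ?thesis by (simp add: Suc ac_simps)
  qed
  have t3: "t n \<le> l n" if "n \<ge> M'" for n
  proof -
    have "\<eta> \<le> F (n + l n) * real L ^ (n + l n)"
      using \<eta> g_mono[of M' "n + l n"] M' that by simp
    then show ?thesis unfolding t_def by (intro Least_le) (simp add: power_add mult.assoc)
  qed
  have split: "F (n + l n) = ?s n * real L ^ t n * (1 / real L ^ (n + t n))" for n
    using L by (simp add: power_add)
  show thesis
  proof (rule that)
    show "\<not> summable (\<lambda>n. 1 / real L ^ t n)"
    proof
      assume "summable (\<lambda>n. 1 / real L ^ t n)"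
      then have "summable (\<lambda>n. \<eta> * real L * (1 / real L ^ t n))" by (rule summable_mult)
      then have "summable ?s"
      proof (rule summable_comparison_test[rotated], intro exI allI impI)
        fix n assume n: "n \<ge> M'"
        have "?s n * real L ^ t n * (1 / real L ^ t n) \<le> \<eta> * real L * (1 / real L ^ t n)"
          by (intro mult_right_mono t2 n) auto
        then show "norm (?s n) \<le> \<eta> * real L * (1 / real L ^ t n)" using s0[of n] L by simp
      qed
      then show False using s_div by blast
    qed
    show "t n \<le> l n" if "n \<ge> M'" for n by (rule t3[OF that])
    show "\<eta> * (1 / real L ^ (n + t n)) \<le> F (n + l n)" for n
      by (rule order_trans[OF mult_right_mono[OF t1[of n]] eq_refl[OF split[of n, symmetric]]]) simp
    show "F (n + l n) \<le> \<eta> * real L * (1 / real L ^ (n + t n))" if "n \<ge> M'" for n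
      by (rule order_trans[OF eq_refl[OF split[of n]] mult_right_mono[OF t2[OF that]]]) simp
  qed
qed

text \<open>
  The enlarged cylinders of suitable levels fill all of \<open>D\<close> but a quarter of its measure, and the coarse
  members of \<open>C\<close> (level at most \<open>M'\<close>) occupy at most another quarter. So the minimal enlarged
  words outside the coarse part form an antichain \<open>B\<close> carrying half of the measure of \<open>D\<close>. The periodic
  extensions \<open>S u\<close> of the \<open>u \<in> B\<close> therefore cost at least \<open>A / 2\<close> times the cost of \<open>D\<close> altogether.

  Suppose that no \<open>S u\<close> is undercovered. If a member \<open>c\<close> of \<open>C\<close> contains some of them, it costs at
  least a fraction \<open>1 / L\<close> of their total: either it sits between a single \<open>u\<close> and \<open>S u\<close>, or it contains
  the cylinders \<open>u\<close> themselves, whose measures add up to at most that of \<open>c\<close>, and the relative cost of \<open>c\<close> is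
  at least \<open>\<eta>\<close>. The remaining \<open>S u\<close> contain disjoint sets of members of \<open>C\<close>, which cost at least a quarter of \<open>S u\<close>
  each. Hence all \<open>S u\<close> together cost at most \<open>(L + 4) * cost C D\<close>, which is less than \<open>A / 4\<close> times the
  cost of \<open>D\<close>.
\<close>

lemma undercovered_refine:
  assumes C: "\<And>c. c \<in> C \<Longrightarrow> c \<in> words L (length c)"
    and summable: "(\<lambda>c. F (length c)) summable_on C"
    and D: "D \<in> words L (length D)" "m1 \<le> length D" "undercovered C D"
  obtains n v where "k \<le> n" "v \<in> words L (n + l n)" "recurs n (l n) v" "prefix D v"
    "undercovered C v"
proof -
  \<comment> \<open>The charging argument at the end loses a factor \<open>L + 4\<close>.\<close>
  define A where "A = real L + 4"
  define \<eta> where "\<eta> = A * (F (length D) * real L ^ length D)"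
  have L1: "L \<ge> 1" "real L > 0" "real L \<ge> 1" using L by auto
  have gD: "1 \<le> F (length D) * real L ^ length D" by (rule g_ge1[OF D(2)])
  have "\<eta> \<ge> 1" using mult_mono[of 1 A 1 "F (length D) * real L ^ length D"] gD by (simp add: \<eta>_def A_def)
  obtain M0 where M0: "m1 \<le> M0" "\<eta> \<le> F M0 * real L ^ M0" using g_unbounded by blast
  define M' where "M' = max (max M0 (length D)) (max k 1)"
  have M': "m1 \<le> M'" "1 \<le> M'" "k \<le> M'" "length D \<le> M'" "M0 \<le> M'" using M0 by (auto simp: M'_def)
  have \<eta>M': "\<eta> \<le> F M' * real L ^ M'" using M0 g_mono[OF M0(1) M'(5)] by linarith
  obtain t where t: "\<not> summable (\<lambda>n. 1 / real L ^ t n)"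
    "\<And>n. n \<ge> M' \<Longrightarrow> t n \<le> l n"
    "\<And>n. n \<ge> M' \<Longrightarrow> \<eta> * (1 / real L ^ (n + t n)) \<le> F (n + l n)"
    "\<And>n. n \<ge> M' \<Longrightarrow> F (n + l n) \<le> \<eta> * real L * (1 / real L ^ (n + t n))"
    using enlarged_recurrence_lengths[OF M'(1,2) \<open>\<eta> \<ge> 1\<close> \<eta>M'] by blast
  have w: "weight L D > 0" using L by (simp add: weight_def)
  then have "weight L D / 4 > 0" by simp
  from almost_all_words_recur[OF L t(1) this M'(2)] obtain N where
    N: "\<And>M. (\<And>n. n \<in> {M'..N} \<Longrightarrow> n + t n \<le> M) \<Longrightarrow>
      real (card {v \<in> words L M. \<forall>n\<in>{M'..N}. \<not> recurs n (t n) v}) \<le> weight L D / 4 * real L ^ M"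
    by blast
  define M where "M = M' + (\<Sum>n\<in>{M'..N}. n + t n)"
  have M: "n + t n \<le> M" if "n \<in> {M'..N}" for n
    using member_le_sum[of n "{M'..N}" "\<lambda>n. n + t n"] that by (simp add: M_def)
  have "M' \<le> M" by (simp add: M_def)

  \<comment> \<open>All enlarged words; the minimal ones below \<open>D\<close> and outside the coarse part of the cover form \<open>B\<close>.\<close>
  define raw where "raw = {u. \<exists>n\<in>{M'..N}. u \<in> words L (n + t n) \<and> recurs n (t n) u}"
  define B where "B = {u \<in> raw. (\<forall>u'\<in>raw. prefix u' u \<longrightarrow> u' = u) \<and> prefix D u \<and>
    (\<forall>c\<in>C. length c \<le> M' \<longrightarrow> \<not> prefix c u)}"
  have "raw \<subseteq> (\<Union>n\<in>{M'..N}. words L (n + t n))" by (auto simp: raw_def)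
  then have "finite raw" by (rule finite_subset) auto
  then have finB: "finite B" by (simp add: B_def)
  have rawW: "u \<in> words L (length u)" "length u \<le> M" "M' \<le> length u" if "u \<in> raw" for u
    using that M by (auto simp: raw_def words_def intro: trans_le_add1)
  have anti: "u = u'" if "u \<in> B" "u' \<in> B" "prefix u u'" for u u'
    using that by (auto simp: B_def)

  define C0 where "C0 = {c \<in> C. prefix D c \<and> length c \<le> M'}"
  have "C0 \<subseteq> (\<Union>n\<in>{..M'}. words L n)" using C by (auto simp: C0_def)
  then have finC0: "finite C0" by (rule finite_subset) auto
  have sum_sub: "(\<lambda>c. F (length c)) summable_on S" if "S \<subseteq> C" for S
    using summable_on_subset_banach[OF summable that] .
  have cost_ge: "(\<Sum>c\<in>S. F (length c)) \<le> cost C D" if "S \<subseteq> {c \<in> C. prefix D c}" "finite S" for S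
    unfolding cost_def using that F_pos by (intro finite_sum_le_infsum sum_sub) (auto intro: less_imp_le)
  have Dcost: "cost C D < F (length D) / 4" and Dno: "\<And>c. c \<in> C \<Longrightarrow> \<not> prefix c D"
    using D(3) by (auto simp: undercovered_def)
  \<comment> \<open>The coarse members of the cover occupy at most a quarter of the measure of \<open>D\<close>.\<close>
  have wC0: "(\<Sum>c\<in>C0. weight L c) \<le> weight L D / 4"
  proof -
    let ?g = "F (length D) * real L ^ length D"
    have "?g * weight L c \<le> F (length c)" if "c \<in> C0" for c
    proof -
      have "?g * weight L c \<le> F (length c) * real L ^ length c * weight L c"
        using that D(2) by (intro mult_right_mono g_mono) (auto simp: C0_def dest: prefix_length_le)
      then show ?thesis using L by (simp add: weight_def)
    qed
    then have "(\<Sum>c\<in>C0. ?g * weight L c) \<le> (\<Sum>c\<in>C0. F (length c))" by (rule sum_mono)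
    also have "\<dots> \<le> cost C D" using finC0 by (intro cost_ge) (auto simp: C0_def)
    also have "\<dots> \<le> F (length D) / 4" using Dcost by simp
    also have "\<dots> = ?g * (weight L D / 4)" using L by (simp add: weight_def)
    finally have "?g * (\<Sum>c\<in>C0. weight L c) \<le> ?g * (weight L D / 4)"
      by (simp only: sum_distrib_left)
    then show ?thesis using gD by (subst (asm) mult_le_cancel_left_pos) auto
  qed

  have wB: "weight L D / 2 \<le> (\<Sum>u\<in>B. weight L u)"
  proof -
    let ?E = "\<lambda>u. {v \<in> words L M. prefix u v}"
    let ?Z = "{v \<in> words L M. \<forall>n\<in>{M'..N}. \<not> recurs n (t n) v}"
    let ?Y = "{v \<in> words L M. \<exists>c\<in>C0. prefix c v}"
    define V where "V = ?E D - ?Y - ?Z"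
    have finV: "finite V" unfolding V_def by (intro finite_Diff) (auto intro: finite_subset[OF _ finite_words])
    have inB: "\<exists>u\<in>B. prefix u v" if v: "v \<in> V" for v
    proof -
      have vM: "v \<in> words L M" "prefix D v" and v0: "\<And>c. c \<in> C0 \<Longrightarrow> \<not> prefix c v"
        using v by (auto simp: V_def)
      obtain n where n: "n \<in> {M'..N}" "recurs n (t n) v" using v by (auto simp: V_def)
      have "take (n + t n) v \<in> raw \<and> prefix (take (n + t n) v) v"
        using n M[OF n(1)] vM recurs_prefix[of "take (n + t n) v" v n "t n"]
        by (auto simp: raw_def take_is_prefix take_in_words words_length intro!: bexI[of _ n])
      then obtain u where u: "u \<in> raw" "prefix u v"
        and least: "\<And>u'. u' \<in> raw \<Longrightarrow> prefix u' v \<Longrightarrow> length u \<le> length u'"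
        using ex_has_least_nat[of "\<lambda>u. u \<in> raw \<and> prefix u v" _ length] by blast
      have "u' = u" if "u' \<in> raw" "prefix u' u" for u'
        using least[OF that(1)] that(2) u(2)
        by (metis prefix_length_prefix prefix_order.antisym prefix_order.trans)
      moreover have "prefix D u"
        using vM(2) u(2) rawW(3)[OF u(1)] M'(4) by (intro prefix_length_prefix[of D v u]) auto
      moreover have "\<not> prefix c u" if "c \<in> C" "length c \<le> M'" for c
      proof
        assume "prefix c u"
        then have cv: "prefix c v" using u(2) by (rule prefix_order.trans)
        then have "prefix D c" using prefix_same_cases[OF cv vM(2)] Dno[OF that(1)] by blast
        then show False using v0[of c] that cv by (auto simp: C0_def)
      qed
      ultimately have "u \<in> B" using u(1) by (auto simp: B_def)
      then show ?thesis using u(2) by blast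
    qed
    have "real L ^ M * weight L D = real (card (?E D))"
      using D(1) L1 M'(4) \<open>M' \<le> M\<close> by (intro card_extensions[symmetric]) auto
    also have "\<dots> \<le> real (card (V \<union> ?Y \<union> ?Z))"
      by (intro of_nat_mono card_mono) (auto simp: V_def)
    also have "\<dots> \<le> real (card V) + real (card ?Y) + real (card ?Z)"
      by (smt (verit) card_Un_le of_nat_add of_nat_mono)
    also have "real (card ?Z) \<le> weight L D / 4 * real L ^ M" by (rule N) (rule M)
    also have "real (card ?Y) \<le> real L ^ M * (\<Sum>c\<in>C0. weight L c)"
      using L1 finC0 C \<open>M' \<le> M\<close> by (intro card_covered_words_le) (auto simp: C0_def)
    also have "real (card V) \<le> real L ^ M * (\<Sum>u\<in>B. weight L u)"
      using L1 finB rawW inB by (intro card_covered_words_le) (auto simp: B_def V_def)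
    also have "real L ^ M * (\<Sum>c\<in>C0. weight L c) \<le> real L ^ M * (weight L D / 4)"
      by (intro mult_left_mono wC0) auto
    finally have "real L ^ M * weight L D \<le> real L ^ M * ((\<Sum>u\<in>B. weight L u) + weight L D / 4 + weight L D / 4)"
      by (simp add: algebra_simps)
    then have "weight L D \<le> (\<Sum>u\<in>B. weight L u) + weight L D / 4 + weight L D / 4"
      using L1 by (subst (asm) mult_le_cancel_left_pos) auto
    then show ?thesis by simp
  qed

  have "\<exists>n v. n \<in> {M'..N} \<and> u \<in> words L (n + t n) \<and> v \<in> words L (n + l n) \<and>
      recurs n (l n) v \<and> prefix u v" if u: "u \<in> B" for u
  proof -
    obtain n where n: "n \<in> {M'..N}" "u \<in> words L (n + t n)" "recurs n (t n) u"
      using u unfolding B_def raw_def by blast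
    then show ?thesis using periodic_extension[of "t n" "l n" n u L] t(2)[of n] M'(2) by auto
  qed
  then obtain nn S where S: "\<And>u. u \<in> B \<Longrightarrow> nn u \<in> {M'..N} \<and> u \<in> words L (nn u + t (nn u)) \<and>
      S u \<in> words L (nn u + l (nn u)) \<and> recurs (nn u) (l (nn u)) (S u) \<and> prefix u (S u)"
    by metis
  have Slen: "length (S u) = nn u + l (nn u)" "weight L u = 1 / real L ^ (nn u + t (nn u))"
    "nn u \<ge> M'" if "u \<in> B" for u
    using S[OF that] by (auto simp: weight_def words_length)
  have FS_ge: "\<eta> * weight L u \<le> F (length (S u))" if "u \<in> B" for u
    unfolding Slen(1,2)[OF that] by (rule t(3)[OF Slen(3)[OF that]])
  have FS_le: "F (length (S u)) \<le> \<eta> * real L * weight L u" if "u \<in> B" for u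
    unfolding Slen(1,2)[OF that] by (rule t(4)[OF Slen(3)[OF that]])
  have DS: "prefix D (S u)" if "u \<in> B" for u
    using S[OF that] that by (auto simp: B_def intro: prefix_order.trans)

  have "\<exists>u\<in>B. undercovered C (S u)"
  proof (rule ccontr)
    assume none: "\<not> (\<exists>u\<in>B. undercovered C (S u))"
    \<comment> \<open>\<open>Ba\<close>: extensions inside a member of the cover; the others have expensive members inside them.\<close>
    define Ba where "Ba = {u \<in> B. \<exists>c\<in>C. prefix c (S u)}"
    have Bb: "F (length (S u)) \<le> 4 * cost C (S u)" if "u \<in> B - Ba" for u
      using that none by (auto simp: undercovered_def Ba_def not_less)
    have "(\<Sum>u\<in>B - Ba. F (length (S u))) \<le> (\<Sum>u\<in>B - Ba. 4 * cost C (S u))"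
      by (intro sum_mono Bb)
    also have "\<dots> = 4 * (\<Sum>u\<in>B - Ba. cost C (S u))" by (simp only: sum_distrib_left)
    also have "(\<Sum>u\<in>B - Ba. cost C (S u)) \<le> cost C D"
      unfolding cost_def
    proof (rule sum_infsum_le_infsum)
      show "{c \<in> C. prefix (S u) c} \<inter> {c \<in> C. prefix (S u') c} = {}"
        if "u \<in> B - Ba" "u' \<in> B - Ba" "u \<noteq> u'" for u u'
      proof -
        have False if "prefix (S u) c" "prefix (S u') c" for c
        proof -
          have "prefix u c" "prefix u' c"
            using that S[of u] S[of u'] \<open>u \<in> B - Ba\<close> \<open>u' \<in> B - Ba\<close>
            by (auto intro: prefix_order.trans)
          then show False
            using prefix_same_cases[of u c u'] anti \<open>u \<in> B - Ba\<close> \<open>u' \<in> B - Ba\<close> \<open>u \<noteq> u'\<close> by blast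
        qed
        then show ?thesis by blast
      qed
    qed (use finB F_pos DS in \<open>auto intro!: sum_sub intro: less_imp_le prefix_order.trans\<close>)
    finally have sum_b: "(\<Sum>u\<in>B - Ba. F (length (S u))) \<le> 4 * cost C D" by simp

    have "\<forall>u\<in>Ba. \<exists>c. c \<in> C \<and> prefix c (S u)" by (auto simp: Ba_def)
    then obtain \<kappa> where \<kappa>: "\<And>u. u \<in> Ba \<Longrightarrow> \<kappa> u \<in> C \<and> prefix (\<kappa> u) (S u)" by metis
    have BaB: "Ba \<subseteq> B" "finite Ba" using finB by (auto simp: Ba_def)
    have \<kappa>D: "prefix D (\<kappa> u)" if "u \<in> Ba" for u
      using \<kappa>[OF that] DS[of u] that BaB Dno[of "\<kappa> u"] prefix_same_cases[of D "S u" "\<kappa> u"] by auto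
    have \<kappa>M: "length (\<kappa> u) > M'" if "u \<in> Ba" for u
    proof (rule ccontr)
      assume "\<not> M' < length (\<kappa> u)"
      then have le: "length (\<kappa> u) \<le> M'" by simp
      have "u \<in> B" using that BaB by auto
      then have "M' \<le> length u" using rawW(3)[of u] by (auto simp: B_def)
      then have "prefix (\<kappa> u) u"
        using \<kappa>[OF that] S[OF \<open>u \<in> B\<close>] le by (intro prefix_length_prefix[of _ "S u" u]) auto
      then show False using \<open>u \<in> B\<close> \<kappa>[OF that] le by (auto simp: B_def)
    qed
    have group: "(\<Sum>u\<in>{u \<in> Ba. \<kappa> u = c}. F (length (S u))) \<le> real L * F (length c)"
      if c: "c \<in> \<kappa> ` Ba" for c
    proof -
      have cM: "M' \<le> length c" "c \<in> C" using c \<kappa>M \<kappa> by (auto intro: less_imp_le)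
      show ?thesis
      \<comment> \<open>Either \<open>c\<close> lies between one \<open>u\<close> and its extension, or it contains every \<open>u\<close> charged to it.\<close>
      proof (cases "\<exists>u\<in>Ba. \<kappa> u = c \<and> prefix u c")
        case True
        then obtain u where u: "u \<in> Ba" "\<kappa> u = c" "prefix u c" by blast
        have "u' = u" if "u' \<in> Ba" "\<kappa> u' = c" for u'
        proof -
          have u': "u' \<in> B" using that(1) BaB(1) by blast
          have "prefix c (S u')" using \<kappa>[OF that(1)] that(2) by blast
          then have "prefix u (S u')" by (rule prefix_order.trans[OF u(3)])
          moreover have "prefix u' (S u')" using S[OF u'] by blast
          moreover have "u \<in> B" "u' \<in> B" using u(1) that(1) BaB(1) by auto
          ultimately show ?thesis using prefix_same_cases[of u "S u'" u'] anti by metis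
        qed
        then have "{u \<in> Ba. \<kappa> u = c} = {u}" using u(1,2) by blast
        then have "(\<Sum>u\<in>{u \<in> Ba. \<kappa> u = c}. F (length (S u))) = F (length (S u))" by simp
        also have "\<dots> \<le> F (length c)"
          using \<kappa>[OF u(1)] u(2) by (intro F_antimono) (auto dest: prefix_length_le)
        also have "\<dots> \<le> real L * F (length c)" using F_pos[of "length c"] L1 by simp
        finally show ?thesis .
      next
        case False
        have pre: "prefix c u" if "u \<in> {u \<in> Ba. \<kappa> u = c}" for u
        proof -
          have "prefix c (S u)" "prefix u (S u)" using that \<kappa>[of u] S[of u] BaB by auto
          then show ?thesis using prefix_same_cases[of c "S u" u] False that by auto
        qed
        have "(\<Sum>u\<in>{u \<in> Ba. \<kappa> u = c}. F (length (S u))) \<le> (\<Sum>u\<in>{u \<in> Ba. \<kappa> u = c}. \<eta> * real L * weight L u)"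
          using BaB by (intro sum_mono FS_le) auto
        also have "\<dots> = \<eta> * real L * (\<Sum>u\<in>{u \<in> Ba. \<kappa> u = c}. weight L u)"
          by (simp only: sum_distrib_left)
        also have "\<dots> \<le> \<eta> * real L * weight L c"
        proof (intro mult_left_mono antichain_weight_le)
          show "u \<in> words L (length u)" if "u \<in> {u \<in> Ba. \<kappa> u = c}" for u
            using that BaB rawW by (auto simp: B_def)
          show "u = u'" if "u \<in> {u \<in> Ba. \<kappa> u = c}" "u' \<in> {u \<in> Ba. \<kappa> u = c}" "prefix u u'" for u u'
            using that BaB by (intro anti) auto
        qed (use L1 BaB cM C pre \<open>\<eta> \<ge> 1\<close> in auto)
        also have "\<dots> = real L * weight L c * \<eta>" by simp
        also have "\<dots> \<le> real L * weight L c * (F (length c) * real L ^ length c)"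
          using \<eta>M' g_mono[OF M'(1) cM(1)] by (intro mult_left_mono) auto
        also have "\<dots> = real L * F (length c)" using L by (simp add: weight_def)
        finally show ?thesis .
      qed
    qed
    have "(\<Sum>u\<in>Ba. F (length (S u))) = (\<Sum>c\<in>\<kappa> ` Ba. \<Sum>u\<in>{u \<in> Ba. \<kappa> u = c}. F (length (S u)))"
      by (rule sum.image_gen[OF BaB(2)])
    also have "\<dots> \<le> (\<Sum>c\<in>\<kappa> ` Ba. real L * F (length c))" by (intro sum_mono group)
    also have "\<dots> = real L * (\<Sum>c\<in>\<kappa> ` Ba. F (length c))" by (simp only: sum_distrib_left)
    also have "(\<Sum>c\<in>\<kappa> ` Ba. F (length c)) \<le> cost C D"
      using BaB \<kappa> \<kappa>D by (intro cost_ge) auto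
    finally have sum_a: "(\<Sum>u\<in>Ba. F (length (S u))) \<le> real L * cost C D" using L1 by simp

    have "(\<Sum>u\<in>B. F (length (S u))) = (\<Sum>u\<in>B - Ba. F (length (S u))) + (\<Sum>u\<in>Ba. F (length (S u)))"
      by (rule sum.subset_diff[OF BaB(1) finB])
    then have "(\<Sum>u\<in>B. F (length (S u))) \<le> A * cost C D"
      using sum_a sum_b by (simp add: A_def algebra_simps)
    moreover have "A * cost C D < A * (F (length D) / 4)"
      using Dcost by (intro mult_strict_left_mono) (auto simp: A_def)
    moreover have "A * (F (length D) / 2) \<le> (\<Sum>u\<in>B. F (length (S u)))"
    proof -
      have "A * (F (length D) / 2) = \<eta> * (weight L D / 2)"
        using L by (simp add: \<eta>_def weight_def)
      also have "\<dots> \<le> \<eta> * (\<Sum>u\<in>B. weight L u)"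
        using wB \<open>\<eta> \<ge> 1\<close> by (intro mult_left_mono) auto
      also have "\<dots> = (\<Sum>u\<in>B. \<eta> * weight L u)" by (simp only: sum_distrib_left)
      also have "\<dots> \<le> (\<Sum>u\<in>B. F (length (S u)))" by (intro sum_mono FS_ge)
      finally show ?thesis .
    qed
    ultimately have "A * (F (length D) / 2) < A * (F (length D) / 4)" by simp
    then have "F (length D) / 2 < F (length D) / 4" by (subst (asm) mult_less_cancel_left_pos) (auto simp: A_def)
    then show False using F_pos[of "length D"] by simp
  qed
  then obtain u where u: "u \<in> B" "undercovered C (S u)" by blast
  show thesis
    using S[OF u(1)] DS[OF u(1)] u(2) M'(3) by (intro that[of "nn u" "S u"]) auto
qed

text \<open>
  Averaging: the \<open>L ^ m\<close> cylinders of level \<open>m\<close> would otherwise contain more than the total cost.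
\<close>

lemma undercovered_start:
  assumes C: "\<And>c. c \<in> C \<Longrightarrow> m < length c"
    and summable: "(\<lambda>c. F (length c)) summable_on C"
    and H: "infsum (\<lambda>c. F (length c)) C < F m * real L ^ m / 4"
  obtains u where "u \<in> words L m" "undercovered C u"
proof -
  have "\<exists>u\<in>words L m. cost C u < F m / 4"
  proof (rule ccontr)
    assume "\<not> (\<exists>u\<in>words L m. cost C u < F m / 4)"
    then have "(\<Sum>u\<in>words L m. F m / 4) \<le> (\<Sum>u\<in>words L m. cost C u)"
      by (intro sum_mono) (auto simp: not_less)
    also have "\<dots> \<le> infsum (\<lambda>c. F (length c)) C"
      unfolding cost_def
    proof (rule sum_infsum_le_infsum[OF finite_words summable])
      fix u u' assume u: "u \<in> words L m" "u' \<in> words L m" "u \<noteq> u'"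
      have False if "prefix u c" "prefix u' c" for c
        using prefix_length_prefix[OF that] prefix_length_prefix[OF that(2,1)] u
          prefix_order.antisym[of u u'] by (simp add: words_length)
      then show "{c \<in> C. prefix u c} \<inter> {c \<in> C. prefix u' c} = {}" by blast
    qed (use F_pos in \<open>auto intro: less_imp_le\<close>)
    finally show False using H by (simp add: card_words mult.commute)
  qed
  then obtain u where u: "u \<in> words L m" "cost C u < F m / 4" by blast
  have "\<not> prefix c u" if "c \<in> C" for c
    using C[OF that] words_length[OF u(1)] by (auto dest: prefix_length_le)
  then show thesis using u by (intro that[of u]) (auto simp: undercovered_def words_length)
qed

text \<open>
  Since the relative cost is unbounded, a level \<open>m\<close> exists at which the descent can start for any cover of total cost
  at most \<open>H\<close> by cylinders finer than \<open>m\<close>. The nested undercovered cylinders define \<open>\<omega>\<close>; a member of \<open>C\<close> containing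
  \<open>\<omega>\<close> would contain one of them.
\<close>

theorem recurrent_point_outside_cheap_cover:
  "\<exists>m. \<forall>C. (\<forall>c\<in>C. c \<in> words L (length c) \<and> m < length c) \<longrightarrow>
     (\<lambda>c. F (length c)) summable_on C \<longrightarrow> infsum (\<lambda>c. F (length c)) C \<le> H \<longrightarrow>
     (\<exists>\<omega>. range \<omega> \<subseteq> {1..L} \<and> infinite {n. 1 \<le> n \<and> (\<forall>i<l n. \<omega> (n + i) = \<omega> i)} \<and>
        (\<forall>c\<in>C. map \<omega> [0..<length c] \<noteq> c))"
proof -
  obtain m where m: "m1 \<le> m" "4 * H + 1 \<le> F m * real L ^ m" using g_unbounded by blast
  show ?thesis
  proof (intro exI[of _ m] allI impI)
    fix C assume C: "\<forall>c\<in>C. c \<in> words L (length c) \<and> m < length c"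
      and summable: "(\<lambda>c. F (length c)) summable_on C"
      and H: "infsum (\<lambda>c. F (length c)) C \<le> H"
    let ?P = "\<lambda>j u. u \<in> words L (length u) \<and> m1 \<le> length u \<and> undercovered C u"
    let ?Q = "\<lambda>j u v. prefix u v \<and> (\<exists>n>length u. length v = n + l n \<and> recurs n (l n) v)"
    obtain u0 where u0: "u0 \<in> words L m" "undercovered C u0"
      using undercovered_start[of C m] C summable H m(2) by auto
    have "\<exists>D. \<forall>j. ?P j (D j) \<and> ?Q j (D j) (D (Suc j))"
    proof (rule dependent_nat_choice)
      show "\<exists>u. ?P 0 u" using u0 m(1) by (auto simp: words_def)
      fix u j assume P: "?P j u"
      obtain n v where v: "Suc (length u) \<le> n" "v \<in> words L (n + l n)" "recurs n (l n) v" "prefix u v"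
        "undercovered C v"
        using undercovered_refine[of C u "Suc (length u)"] C summable P by blast
      have len: "length v = n + l n" using v(2) by (rule words_length)
      have "v \<in> words L (length v)" "m1 \<le> length v" "length u < n"
        using v(1,2) P unfolding len by auto
      then show "\<exists>v. ?P (Suc j) v \<and> ?Q j u v" using v len by blast
    qed
    then obtain D where D: "\<And>j. ?P j (D j)" "\<And>j. ?Q j (D j) (D (Suc j))" by blast
    have chain: "prefix (D i) (D j)" if "i \<le> j" for i j
      using that
    proof (induction j rule: dec_induct)
      case (step j)
      show ?case by (rule prefix_order.trans[OF step.IH]) (use D(2)[of j] in blast)
    qed simp
    have lenS: "length (D j) < length (D (Suc j))" for j using D(2)[of j] by auto
    have len: "j \<le> length (D j)" for j
    proof (induction j)
      case (Suc j)
      then show ?case using lenS[of j] by simp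
    qed simp
    \<comment> \<open>\<open>D (Suc i)\<close> is the first of the words certain to have an \<open>i\<close>-th letter.\<close>
    define \<omega> where "\<omega> i = D (Suc i) ! i" for i
    have \<omega>: "\<omega> i = D j ! i" if "i < length (D j)" for i j
    proof -
      have nth: "xs ! i = ys ! i" if "prefix xs ys" "i < length xs" for xs ys :: "nat list"
        using that by (auto simp: prefix_def nth_append)
      have "i < length (D (Suc i))" using len[of "Suc i"] by simp
      then have "D (Suc i) ! i = D j ! i"
        using nth[OF chain[of "Suc i" j]] nth[OF chain[of j "Suc i"] that] by (metis nle_le)
      then show ?thesis by (simp only: \<omega>_def)
    qed
    have map: "map \<omega> [0..<length (D j)] = D j" for j
      by (rule nth_equalityI) (auto simp: \<omega>)
    show "\<exists>\<omega>. range \<omega> \<subseteq> {1..L} \<and> infinite {n. 1 \<le> n \<and> (\<forall>i<l n. \<omega> (n + i) = \<omega> i)} \<and>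
        (\<forall>c\<in>C. map \<omega> [0..<length c] \<noteq> c)"
    proof (intro exI[of _ \<omega>] conjI ballI)
      show "range \<omega> \<subseteq> {1..L}"
      proof clarify
        fix i show "\<omega> i \<in> {1..L}"
          unfolding \<omega>_def using D(1)[of "Suc i"] len[of "Suc i"] by (intro words_nth) auto
      qed
      show "infinite {n. 1 \<le> n \<and> (\<forall>i<l n. \<omega> (n + i) = \<omega> i)}"
        unfolding infinite_nat_iff_unbounded
      proof
        fix k
        obtain n where n: "length (D k) < n" "length (D (Suc k)) = n + l n" "recurs n (l n) (D (Suc k))"
          using D(2)[of k] by auto
        have "\<omega> (n + i) = \<omega> i" if "i < l n" for i
          using n that \<omega>[of "n + i" "Suc k"] \<omega>[of i "Suc k"] by (auto simp: recurs_def)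
        then show "\<exists>n>k. n \<in> {n. 1 \<le> n \<and> (\<forall>i<l n. \<omega> (n + i) = \<omega> i)}"
          using n(1) len[of k] by (intro exI[of _ n]) auto
      qed
      show "map \<omega> [0..<length c] \<noteq> c" if "c \<in> C" for c
      proof
        assume eq: "map \<omega> [0..<length c] = c"
        have "c = take (length c) (map \<omega> [0..<length (D (length c))])"
          using len[of "length c"] by (subst eq[symmetric]) (simp add: take_map)
        then have "prefix c (D (length c))" unfolding map by (metis take_is_prefix)
        then show False using D(1)[of "length c"] that by (auto simp: undercovered_def)
      qed
    qed
  qed
qed

end

section \<open>Hausdorff content and measure\<close>

lemma infsum_ennreal_le:
  fixes g :: "'b \<Rightarrow> ennreal"
  assumes "\<And>P. finite P \<Longrightarrow> P \<subseteq> J \<Longrightarrow> sum g P \<le> c"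
  shows "infsum g J \<le> c"
  using assms by (subst nonneg_infsum_complete) (auto intro!: SUP_least)

lemma sum_le_infsum_ennreal:
  fixes g :: "'b \<Rightarrow> ennreal"
  assumes "finite P" "P \<subseteq> J"
  shows "sum g P \<le> infsum g J"
  using assms by (subst nonneg_infsum_complete) (auto intro!: SUP_upper)

lemma infsum_ennreal_finite_iff_summable:
  fixes A :: "nat \<Rightarrow> real"
  assumes "\<And>n. n \<ge> 1 \<Longrightarrow> A n \<ge> 0"
  shows "(\<Sum>\<^sub>\<infinity>n\<in>{1..}. ennreal (A n)) < \<infinity> \<longleftrightarrow> summable A"
proof
  assume fin: "(\<Sum>\<^sub>\<infinity>n\<in>{1..}. ennreal (A n)) < \<infinity>"
  then obtain c where c: "c \<ge> 0" "(\<Sum>\<^sub>\<infinity>n\<in>{1..}. ennreal (A n)) = ennreal c"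
    by (cases "\<Sum>\<^sub>\<infinity>n\<in>{1..}. ennreal (A n)") (auto simp: top_unique)
  have "summable (\<lambda>n. A (Suc n))"
  proof (rule summableI_nonneg_bounded)
    fix N
    have "ennreal (\<Sum>n<N. A (Suc n)) = (\<Sum>n<N. ennreal (A (Suc n)))"
      using assms by (intro sum_ennreal[symmetric]) auto
    also have "\<dots> = (\<Sum>n\<in>Suc ` {..<N}. ennreal (A n))" by (simp add: sum.reindex)
    also have "\<dots> \<le> ennreal c" unfolding c(2)[symmetric] by (intro sum_le_infsum_ennreal) auto
    finally show "(\<Sum>n<N. A (Suc n)) \<le> c" using c(1) by simp
  qed (use assms in auto)
  then show "summable A" by (simp add: summable_Suc_iff)
next
  assume "summable A"
  then have s: "summable (\<lambda>n. A (Suc n))" by (simp add: summable_Suc_iff)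
  have "(\<Sum>\<^sub>\<infinity>n\<in>{1..}. ennreal (A n)) \<le> ennreal (\<Sum>n. A (Suc n))"
  proof (rule infsum_ennreal_le)
    fix P :: "nat set" assume P: "finite P" "P \<subseteq> {1..}"
    have im: "P = Suc ` ((\<lambda>n. n - 1) ` P)" using P(2) by (force simp: image_image)
    have "(\<Sum>n\<in>P. ennreal (A n)) = ennreal (\<Sum>n\<in>P. A n)"
      using assms P by (intro sum_ennreal) auto
    also have "(\<Sum>n\<in>P. A n) = (\<Sum>n\<in>(\<lambda>n. n - 1) ` P. A (Suc n))"
      by (subst im, subst sum.reindex) auto
    also have "\<dots> \<le> (\<Sum>n. A (Suc n))"
      using P assms by (intro sum_le_suminf s) auto
    finally show "(\<Sum>n\<in>P. ennreal (A n)) \<le> ennreal (\<Sum>n. A (Suc n))" by (simp add: ennreal_leI)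
  qed
  also have "\<dots> < \<infinity>" by simp
  finally show "(\<Sum>\<^sub>\<infinity>n\<in>{1..}. ennreal (A n)) < \<infinity>" .
qed

text \<open>
  Covers given by index sets other than subsets of \<open>\<nat>\<close>, such as words or pairs, are transported along an
  enumeration.
\<close>

lemma hausdorff_content_le_infsum:
  fixes x :: "'b \<Rightarrow> 'a::metric_space"
  assumes J: "countable J" and F: "F \<subseteq> X"
    and r: "\<And>j. j \<in> J \<Longrightarrow> x j \<in> X \<and> 0 < r j \<and> r j \<le> \<tau>"
    and cover: "\<And>y. y \<in> F \<Longrightarrow> \<exists>j\<in>J. dist (x j) y < r j"
  shows "hausdorff_content X f \<tau> F \<le> (\<Sum>\<^sub>\<infinity>j\<in>J. ennreal (f (2 * r j)))"
proof -
  let ?e = "to_nat_on J" and ?d = "from_nat_into J"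
  have de: "?d (?e j) = j" if "j \<in> J" for j using from_nat_into_to_nat_on[OF J that] .
  have "hausdorff_cover X \<tau> F (?e ` J) (\<lambda>i. x (?d i)) (\<lambda>i. r (?d i))"
    unfolding hausdorff_cover_def using r cover F de by (fastforce simp: mem_ball)
  then have "hausdorff_content X f \<tau> F \<le> (\<Sum>\<^sub>\<infinity>i\<in>?e ` J. ennreal (f (2 * r (?d i))))"
    unfolding hausdorff_content_def
    by (intro Inf_lower CollectI exI[of _ "?e ` J"] exI[of _ "\<lambda>i. x (?d i)"] exI[of _ "\<lambda>i. r (?d i)"]) simp
  also have "\<dots> = (\<Sum>\<^sub>\<infinity>j\<in>J. ennreal (f (2 * r j)))"
    using inj_on_to_nat_on[OF J] by (subst infsum_reindex) (auto intro!: infsum_cong simp: de)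
  finally show ?thesis .
qed

lemma hausdorff_content_cover:
  assumes "hausdorff_content X f \<tau> F < c"
  obtains I x r where "hausdorff_cover X \<tau> F I x r" "(\<Sum>\<^sub>\<infinity>i\<in>I. ennreal (f (2 * r i))) < c"
  using assms unfolding hausdorff_content_def Inf_less_iff by blast

lemma hausdorff_content_mono:
  assumes "F \<subseteq> G"
  shows "hausdorff_content X f \<tau> F \<le> hausdorff_content X f \<tau> G"
  unfolding hausdorff_content_def hausdorff_cover_def
  using assms by (intro Inf_superset_mono) blast

lemma hausdorff_measure_mono:
  assumes "F \<subseteq> G"
  shows "hausdorff_measure X f F \<le> hausdorff_measure X f G"
  unfolding hausdorff_measure_eq_SUP
  using hausdorff_content_mono[OF assms] by (intro SUP_mono) blast

lemma hausdorff_content_le_measure: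
  "\<tau> > 0 \<Longrightarrow> hausdorff_content X f \<tau> F \<le> hausdorff_measure X f F"
  unfolding hausdorff_measure_eq_SUP by (intro SUP_upper) auto

lemma hausdorff_measure_leI:
  assumes "\<And>\<tau>. \<tau> > 0 \<Longrightarrow> hausdorff_content X f \<tau> F \<le> c"
  shows "hausdorff_measure X f F \<le> c"
  unfolding hausdorff_measure_eq_SUP using assms by (intro SUP_least) auto

text \<open>
  Countable subadditivity, as for any outer measure built from covers: the \<open>n\<close>-th set is covered up to
  an excess of \<open>e / 2 ^ (n + 1)\<close>.
\<close>

lemma hausdorff_content_UN_le:
  fixes A :: "nat \<Rightarrow> 'a::metric_space set"
  assumes A: "\<And>n. n \<in> J \<Longrightarrow> A n \<subseteq> X"
  shows "hausdorff_content X f \<tau> (\<Union>n\<in>J. A n) \<le> (\<Sum>\<^sub>\<infinity>n\<in>J. hausdorff_content X f \<tau> (A n))"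
    (is "_ \<le> ?S")
proof (rule ennreal_le_epsilon)
  fix e :: real assume S: "?S < top" and e: "0 < e"
  let ?h = "\<lambda>n. hausdorff_content X f \<tau> (A n)"
  have "\<exists>I x r. hausdorff_cover X \<tau> (A n) I x r \<and>
      (\<Sum>\<^sub>\<infinity>i\<in>I. ennreal (f (2 * r i))) < ?h n + ennreal (e / 2 * (1/2) ^ n)" if n: "n \<in> J" for n
  proof -
    have "?h n \<le> ?S" using sum_le_infsum_ennreal[of "{n}" J ?h] n by simp
    then have "?h n \<noteq> top" using S by (auto simp: top_unique)
    moreover have "0 < ennreal (e / 2 * (1/2) ^ n)" using e by simp
    ultimately have "?h n < ?h n + ennreal (e / 2 * (1/2) ^ n)"
      by (simp add: ennreal_add_left_cancel_less less_top)
    then show ?thesis by (rule hausdorff_content_cover) blast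
  qed
  then obtain I x r where Ixr: "\<And>n. n \<in> J \<Longrightarrow> hausdorff_cover X \<tau> (A n) (I n) (x n) (r n)"
    and cost: "\<And>n. n \<in> J \<Longrightarrow>
      (\<Sum>\<^sub>\<infinity>i\<in>I n. ennreal (f (2 * r n i))) < ?h n + ennreal (e / 2 * (1/2) ^ n)"
    by metis
  have "hausdorff_content X f \<tau> (\<Union>n\<in>J. A n) \<le>
      (\<Sum>\<^sub>\<infinity>p\<in>Sigma J I. ennreal (f (2 * (case p of (n, i) \<Rightarrow> r n i))))"
  proof (rule hausdorff_content_le_infsum[where x = "\<lambda>(n, i). x n i"])
    show "\<exists>p\<in>Sigma J I. dist (case p of (n, i) \<Rightarrow> x n i) y < (case p of (n, i) \<Rightarrow> r n i)"
      if y: "y \<in> (\<Union>n\<in>J. A n)" for y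
    proof -
      obtain n where n: "n \<in> J" "y \<in> A n" using y by blast
      then obtain i where "i \<in> I n" "y \<in> ball (x n i) (r n i)"
        using Ixr[OF n(1)] unfolding hausdorff_cover_def by blast
      then show ?thesis using n by (intro bexI[of _ "(n, i)"]) auto
    qed
  qed (use A Ixr in \<open>auto simp: hausdorff_cover_def\<close>)
  also have "\<dots> \<le> ?S + ennreal e"
  proof (rule infsum_ennreal_le)
    fix P assume P: "finite P" "P \<subseteq> Sigma J I"
    let ?w = "\<lambda>n i. ennreal (f (2 * r n i))"
    let ?Q = "fst ` P"
    have fQ: "finite ?Q" "?Q \<subseteq> J" using P by auto
    have fin: "finite {i. (n, i) \<in> P}" for n
      using finite_vimageI[OF P(1), of "Pair n"] by (simp add: vimage_def inj_on_def)
    have "P = (SIGMA n:?Q. {i. (n, i) \<in> P})" by force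
    then have "(\<Sum>p\<in>P. ennreal (f (2 * (case p of (n, i) \<Rightarrow> r n i)))) =
        (\<Sum>p\<in>(SIGMA n:?Q. {i. (n, i) \<in> P}). ennreal (f (2 * (case p of (n, i) \<Rightarrow> r n i))))"
      by simp
    also have "\<dots> = (\<Sum>n\<in>?Q. \<Sum>i\<in>{i. (n, i) \<in> P}. ?w n i)"
    proof (subst sum.Sigma)
      show "\<forall>n\<in>?Q. finite {i. (n, i) \<in> P}" using fin by blast
    qed (use fQ in \<open>auto intro!: sum.cong\<close>)
    also have "\<dots> \<le> (\<Sum>n\<in>?Q. ?h n + ennreal (e / 2 * (1/2) ^ n))"
    proof (rule sum_mono)
      fix n assume n: "n \<in> ?Q"
      have "(\<Sum>i\<in>{i. (n, i) \<in> P}. ?w n i) \<le> (\<Sum>\<^sub>\<infinity>i\<in>I n. ?w n i)"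
      proof (rule sum_le_infsum_ennreal)
        show "finite {i. (n, i) \<in> P}" by (rule fin)
      qed (use P in auto)
      also have "\<dots> \<le> ?h n + ennreal (e / 2 * (1/2) ^ n)"
        using cost n fQ by (auto intro: less_imp_le)
      finally show "(\<Sum>i\<in>{i. (n, i) \<in> P}. ?w n i) \<le> ?h n + ennreal (e / 2 * (1/2) ^ n)" .
    qed
    also have "\<dots> = (\<Sum>n\<in>?Q. ?h n) + (\<Sum>n\<in>?Q. ennreal (e / 2 * (1/2) ^ n))" by (rule sum.distrib)
    also have "(\<Sum>n\<in>?Q. ?h n) \<le> ?S" by (rule sum_le_infsum_ennreal[OF fQ])
    also have "(\<Sum>n\<in>?Q. ennreal (e / 2 * (1/2) ^ n)) = ennreal (\<Sum>n\<in>?Q. e / 2 * (1/2) ^ n)"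
      using e by (intro sum_ennreal) auto
    also have "(\<Sum>n\<in>?Q. e / 2 * (1/2) ^ n) \<le> (\<Sum>n. e / 2 * (1/2) ^ n)"
      using fQ e by (intro sum_le_suminf summable_mult summable_geometric) auto
    also have "(\<Sum>n. e / 2 * (1/2) ^ n) = e"
      by (subst suminf_mult) (simp_all add: suminf_geometric)
    finally show "(\<Sum>p\<in>P. ennreal (f (2 * (case p of (n, i) \<Rightarrow> r n i)))) \<le> ?S + ennreal e"
      by (simp add: add_mono ennreal_leI)
  qed
  finally show "hausdorff_content X f \<tau> (\<Union>n\<in>J. A n) \<le> ?S + ennreal e" .
qed

lemma hausdorff_measure_UN_null:
  assumes "\<And>n::nat. A n \<subseteq> X" "\<And>n. hausdorff_measure X f (A n) = 0"
  shows "hausdorff_measure X f (\<Union>n. A n) = 0"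
proof -
  have "hausdorff_content X f \<tau> (\<Union>n. A n) \<le> 0" if "\<tau> > 0" for \<tau>
  proof -
    have "hausdorff_content X f \<tau> (A n) = 0" for n
      using hausdorff_content_le_measure[OF that, of X f "A n"] assms(2)[of n] by simp
    then show ?thesis using hausdorff_content_UN_le[of UNIV A X f \<tau>] assms(1) by simp
  qed
  then show ?thesis using hausdorff_measure_leI[of X f "\<Union>n. A n" 0] by simp
qed

lemma hausdorff_measure_Un_null:
  assumes "A \<subseteq> X" "B \<subseteq> X" "hausdorff_measure X f B = 0"
  shows "hausdorff_measure X f (A \<union> B) \<le> hausdorff_measure X f A"
proof (rule hausdorff_measure_leI)
  fix \<tau> :: real assume \<tau>: "\<tau> > 0"
  let ?A = "\<lambda>n::nat. if n = 0 then A else B"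
  have B: "hausdorff_content X f \<tau> B = 0"
    using hausdorff_content_le_measure[OF \<tau>, of X f B] assms(3) by simp
  have "hausdorff_content X f \<tau> (A \<union> B) = hausdorff_content X f \<tau> (\<Union>n\<in>{0,1}. ?A n)" by (simp add: Un_commute)
  also have "\<dots> \<le> (\<Sum>\<^sub>\<infinity>n\<in>{0,1}. hausdorff_content X f \<tau> (?A n))"
    using assms by (intro hausdorff_content_UN_le) auto
  also have "\<dots> = hausdorff_content X f \<tau> A" using B by simp
  also have "\<dots> \<le> hausdorff_measure X f A" by (rule hausdorff_content_le_measure[OF \<tau>])
  finally show "hausdorff_content X f \<tau> (A \<union> B) \<le> hausdorff_measure X f A" .
qed

section \<open>Coding of the attractor\<close>

lemma ifs_comp_diff: "ifs_comp \<rho> a \<omega> n x - ifs_comp \<rho> a \<omega> n y = \<rho> ^ n * (x - y)"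
proof (induction n arbitrary: x y)
  case (Suc n)
  show ?case using Suc[of "ifs_map \<rho> a (\<omega> n) x" "ifs_map \<rho> a (\<omega> n) y"]
    by (simp add: ifs_map_def algebra_simps)
qed simp

lemma ifs_comp_cong: "(\<And>i. i < n \<Longrightarrow> \<omega> i = \<omega>' i) \<Longrightarrow> ifs_comp \<rho> a \<omega> n = ifs_comp \<rho> a \<omega>' n"
  by (induction n) auto

locale self_similar_set =
  fixes L :: nat and \<rho> :: real and a :: "nat \<Rightarrow> real" and K :: "real set"
  assumes L2: "2 \<le> L" and rho: "0 < \<rho>" "\<rho> < 1"
    and a_mono: "strict_mono_on {1..L} a" and a_first: "0 \<le> a 1" and a_last: "a L \<le> 1 - \<rho>"
    and attractor: "is_attractor \<rho> a L K"
    and separated: "strong_separation \<rho> a L K"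
begin

lemma translation_bounds: "j \<in> {1..L} \<Longrightarrow> 0 \<le> a j" "j \<in> {1..L} \<Longrightarrow> a j \<le> 1 - \<rho>"
proof -
  assume j: "j \<in> {1..L}"
  have "a 1 \<le> a j" "a j \<le> a L"
    using j a_mono L2 by (auto simp: strict_mono_on_leD)
  then show "0 \<le> a j" "a j \<le> 1 - \<rho>" using a_first a_last by auto
qed

definition digits :: "(nat \<Rightarrow> nat) set" where
  "digits = {\<omega>. range \<omega> \<subseteq> {1..L}}"

text \<open>
  The series form of the coding map; \<open>coding_map_eq\<close> identifies the two.
\<close>

definition point :: "(nat \<Rightarrow> nat) \<Rightarrow> real" where
  "point \<omega> = (\<Sum>i. \<rho> ^ i * a (\<omega> i))"

lemma digits_nth: "\<omega> \<in> digits \<Longrightarrow> \<omega> i \<in> {1..L}"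
  by (auto simp: digits_def simp del: atLeastAtMost_iff)

lemma digits_shift: "\<omega> \<in> digits \<Longrightarrow> (\<lambda>i. \<omega> (i + n)) \<in> digits"
  by (auto simp: digits_def simp del: atLeastAtMost_iff)

lemma point_summable:
  assumes "\<omega> \<in> digits"
  shows "summable (\<lambda>i. \<rho> ^ i * a (\<omega> i))"
proof (rule summable_comparison_test)
  show "\<exists>N. \<forall>n\<ge>N. norm (\<rho> ^ n * a (\<omega> n)) \<le> \<rho> ^ n * (1 - \<rho>)"
    using translation_bounds[OF digits_nth[OF assms]] rho
    by (auto simp: abs_mult intro!: mult_left_mono)
  show "summable (\<lambda>n. \<rho> ^ n * (1 - \<rho>))" using rho by (intro summable_mult2 summable_geometric) auto
qed

lemma point_bounds:
  assumes "\<omega> \<in> digits"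
  shows "0 \<le> point \<omega>" "point \<omega> \<le> 1"
proof -
  show "0 \<le> point \<omega>" unfolding point_def
    using translation_bounds[OF digits_nth[OF assms]] rho by (intro suminf_nonneg point_summable assms) auto
  have "point \<omega> \<le> (\<Sum>i. \<rho> ^ i * (1 - \<rho>))" unfolding point_def
    using translation_bounds[OF digits_nth[OF assms]] rho
    by (intro suminf_le point_summable assms summable_mult2 summable_geometric mult_left_mono) auto
  also have "\<dots> = 1" using rho by (subst suminf_mult2[symmetric]) (auto simp: suminf_geometric summable_geometric)
  finally show "point \<omega> \<le> 1" .
qed

lemma point_Suc:
  assumes "\<omega> \<in> digits"
  shows "point \<omega> = ifs_map \<rho> a (\<omega> 0) (point (\<lambda>i. \<omega> (Suc i)))"
proof -
  have "summable (\<lambda>i. \<rho> ^ i * a (\<omega> (Suc i)))"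
    using point_summable[OF digits_shift[OF assms, of 1]] by simp
  then have "\<rho> * point (\<lambda>i. \<omega> (Suc i)) = (\<Sum>i. \<rho> ^ Suc i * a (\<omega> (Suc i)))"
    unfolding point_def by (subst suminf_mult[symmetric]) (auto simp: ac_simps)
  then show ?thesis
    using suminf_split_head[OF point_summable[OF assms]] by (simp add: point_def ifs_map_def)
qed

lemma point_split:
  assumes "\<omega> \<in> digits"
  shows "point \<omega> = ifs_comp \<rho> a \<omega> n (point (\<lambda>i. \<omega> (i + n)))"
proof (induction n)
  case (Suc n)
  then show ?case using point_Suc[OF digits_shift[OF assms, of n]] by simp
qed simp

lemma point_diff:
  assumes "\<omega> \<in> digits" "\<omega>' \<in> digits" "\<And>i. i < n \<Longrightarrow> \<omega> i = \<omega>' i"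
  shows "point \<omega> - point \<omega>' = \<rho> ^ n * (point (\<lambda>i. \<omega> (i + n)) - point (\<lambda>i. \<omega>' (i + n)))"
proof -
  have "ifs_comp \<rho> a \<omega>' n = ifs_comp \<rho> a \<omega> n" by (rule ifs_comp_cong) (simp add: assms(3))
  then show ?thesis
    using point_split[OF assms(1), of n] point_split[OF assms(2), of n]
    by (simp add: ifs_comp_diff)
qed

lemma point_close:
  assumes "\<omega> \<in> digits" "\<omega>' \<in> digits" "\<And>i. i < n \<Longrightarrow> \<omega> i = \<omega>' i"
  shows "\<bar>point \<omega> - point \<omega>'\<bar> \<le> \<rho> ^ n"
proof -
  have "\<bar>point (\<lambda>i. \<omega> (i + n)) - point (\<lambda>i. \<omega>' (i + n))\<bar> \<le> 1"
    using point_bounds[OF digits_shift[OF assms(1), of n]] point_bounds[OF digits_shift[OF assms(2), of n]]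
    by auto
  moreover have "point \<omega> - point \<omega>' = \<rho> ^ n * (point (\<lambda>i. \<omega> (i + n)) - point (\<lambda>i. \<omega>' (i + n)))"
    by (intro point_diff assms)
  ultimately show ?thesis using rho by (simp add: abs_mult mult_left_le)
qed

lemma K_props: "compact K" "K \<noteq> {}" "K \<subseteq> {0..1}" "K = (\<Union>j\<in>{1..L}. ifs_map \<rho> a j ` K)"
  using attractor unfolding is_attractor_def by blast+

lemma eq_if_close:
  assumes "\<And>n. n \<ge> 1 \<Longrightarrow> \<bar>x - y\<bar> \<le> \<rho> ^ n"
  shows "x = y"
proof -
  have "(\<lambda>n. \<rho> ^ n) \<longlonglongrightarrow> 0" using rho by (intro LIMSEQ_realpow_zero) auto
  then have "\<bar>x - y\<bar> \<le> 0"
    by (rule LIMSEQ_le_const) (use assms in auto)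
  then show ?thesis by simp
qed

lemma point_in_K:
  assumes "\<omega> \<in> digits"
  shows "point \<omega> \<in> K"
proof -
  obtain y where y: "y \<in> K" using K_props by blast
  have inK: "ifs_comp \<rho> a \<omega> n z \<in> K" if "z \<in> K" for n z
    using that
  proof (induction n arbitrary: z)
    case (Suc n)
    have "ifs_map \<rho> a (\<omega> n) z \<in> K" using K_props(4) digits_nth[OF assms, of n] Suc.prems by blast
    then show ?case using Suc.IH by simp
  qed simp
  have "(\<lambda>n. ifs_comp \<rho> a \<omega> n y) \<longlonglongrightarrow> point \<omega>"
  proof (rule metric_LIMSEQ_I)
    fix e :: real assume "0 < e"
    then obtain N where N: "\<rho> ^ N < e" using real_arch_pow_inv rho by blast
    show "\<exists>N. \<forall>n\<ge>N. dist (ifs_comp \<rho> a \<omega> n y) (point \<omega>) < e"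
    proof (intro exI allI impI)
      fix n assume n: "N \<le> n"
      let ?z = "point (\<lambda>i. \<omega> (i + n))"
      have "\<bar>y - ?z\<bar> \<le> 1"
        using point_bounds[OF digits_shift[OF assms, of n]] y K_props(3) by fastforce
      have "dist (ifs_comp \<rho> a \<omega> n y) (point \<omega>) = \<rho> ^ n * \<bar>y - ?z\<bar>"
        using point_split[OF assms, of n] rho by (simp add: dist_real_def ifs_comp_diff abs_mult)
      also have "\<dots> \<le> \<rho> ^ n" using \<open>\<bar>y - ?z\<bar> \<le> 1\<close> rho by (simp add: mult_left_le)
      also have "\<dots> \<le> \<rho> ^ N" using n rho by (intro power_decreasing) auto
      finally show "dist (ifs_comp \<rho> a \<omega> n y) (point \<omega>) < e" using N by simp
    qed
  qed
  then show ?thesis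
    by (rule closed_sequentially[OF compact_imp_closed[OF K_props(1)], rotated]) (rule inK[OF y])
qed

lemma K_eq_points: "K = point ` digits"
proof
  show "point ` digits \<subseteq> K" using point_in_K by blast
  show "K \<subseteq> point ` digits"
  proof
    fix x assume x: "x \<in> K"
    have "\<exists>y. \<forall>n. (y n \<in> K \<and> (n = 0 \<longrightarrow> y n = x)) \<and> (\<exists>j\<in>{1..L}. y n = ifs_map \<rho> a j (y (Suc n)))"
    proof (rule dependent_nat_choice)
      show "\<exists>y. y \<in> K \<and> ((0::nat) = 0 \<longrightarrow> y = x)" using x by simp
      fix y :: real and n :: nat assume "y \<in> K \<and> (n = 0 \<longrightarrow> y = x)"
      then have "y \<in> (\<Union>j\<in>{1..L}. ifs_map \<rho> a j ` K)" using K_props(4) by blast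
      then show "\<exists>y'. (y' \<in> K \<and> (Suc n = 0 \<longrightarrow> y' = x)) \<and> (\<exists>j\<in>{1..L}. y = ifs_map \<rho> a j y')"
        by auto
    qed
    then obtain y where y: "\<And>n. y n \<in> K" "y 0 = x"
      "\<And>n. \<exists>j\<in>{1..L}. y n = ifs_map \<rho> a j (y (Suc n))" by metis
    then obtain \<omega> where \<omega>: "\<And>n. \<omega> n \<in> {1..L}" "\<And>n. y n = ifs_map \<rho> a (\<omega> n) (y (Suc n))" by metis
    have d: "\<omega> \<in> digits" using \<omega>(1) by (auto simp: digits_def simp del: atLeastAtMost_iff)
    have x_n: "x = ifs_comp \<rho> a \<omega> n (y n)" for n
    proof (induction n)
      case (Suc n)
      then show ?case using \<omega>(2)[of n] by simp
    qed (simp add: y)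
    have "x = point \<omega>"
    proof (rule eq_if_close)
      fix n
      have "\<bar>y n - point (\<lambda>i. \<omega> (i + n))\<bar> \<le> 1"
        using point_bounds[OF digits_shift[OF d, of n]] y(1)[of n] K_props(3) by fastforce
      then have "\<bar>\<rho> ^ n * (y n - point (\<lambda>i. \<omega> (i + n)))\<bar> \<le> \<rho> ^ n"
        using rho by (simp add: abs_mult mult_left_le)
      then show "\<bar>x - point \<omega>\<bar> \<le> \<rho> ^ n"
        using x_n[of n] point_split[OF d, of n] by (simp add: ifs_comp_diff)
    qed
    then show "x \<in> point ` digits" using d by blast
  qed
qed

lemma separation_gap:
  obtains \<delta> where "\<delta> > 0" "\<And>\<omega> \<omega>'. \<omega> \<in> digits \<Longrightarrow> \<omega>' \<in> digits \<Longrightarrow> \<omega> 0 \<noteq> \<omega>' 0 \<Longrightarrow> \<delta> \<le> \<bar>point \<omega> - point \<omega>'\<bar>"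
proof -
  let ?P = "{(j, k). j \<in> {1..L} \<and> k \<in> {1..L} \<and> j \<noteq> k}"
  define I where "I = (\<lambda>j. ifs_map \<rho> a j ` K)"
  have comp: "compact (I j)" for j
    unfolding I_def ifs_map_def by (intro compact_continuous_image K_props continuous_intros)
  have "\<exists>d>0. \<forall>x\<in>I j. \<forall>y\<in>I k. d \<le> dist x y" if "(j, k) \<in> ?P" for j k
  proof (rule separate_compact_closed)
    show "I j \<inter> I k = {}"
      using separated that unfolding strong_separation_def disjoint_family_on_def I_def by blast
  qed (use comp compact_imp_closed in auto)
  then have "\<exists>d>0. \<forall>x\<in>I (fst p). \<forall>y\<in>I (snd p). d \<le> dist x y" if "p \<in> ?P" for p
    using that by (cases p) simp
  then have "\<forall>p\<in>?P. \<exists>d. d > 0 \<and> (\<forall>x\<in>I (fst p). \<forall>y\<in>I (snd p). d \<le> dist x y)" by blast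
  from bchoice[OF this] obtain d where
    "\<forall>p\<in>?P. d p > 0 \<and> (\<forall>x\<in>I (fst p). \<forall>y\<in>I (snd p). d p \<le> dist x y)" ..
  then have d: "\<And>p. p \<in> ?P \<Longrightarrow> d p > 0"
    "\<And>p x y. p \<in> ?P \<Longrightarrow> x \<in> I (fst p) \<Longrightarrow> y \<in> I (snd p) \<Longrightarrow> d p \<le> dist x y" by blast+
  have fin: "finite ?P" by (rule finite_subset[of _ "{1..L} \<times> {1..L}"]) auto
  define \<delta> where "\<delta> = Min (insert 1 (d ` ?P))"
  have "\<delta> > 0" unfolding \<delta>_def using fin d(1) by (subst Min_gr_iff) auto
  moreover have "\<delta> \<le> \<bar>point \<omega> - point \<omega>'\<bar>" if w: "\<omega> \<in> digits" "\<omega>' \<in> digits" "\<omega> 0 \<noteq> \<omega>' 0" for \<omega> \<omega>'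
  proof -
    have p: "(\<omega> 0, \<omega>' 0) \<in> ?P" using w digits_nth by auto
    have "point \<omega> \<in> I (\<omega> 0)" "point \<omega>' \<in> I (\<omega>' 0)"
      using point_Suc[OF w(1)] point_Suc[OF w(2)] point_in_K[OF digits_shift[OF w(1), of 1]]
        point_in_K[OF digits_shift[OF w(2), of 1]] by (auto simp: I_def)
    then have "d (\<omega> 0, \<omega>' 0) \<le> \<bar>point \<omega> - point \<omega>'\<bar>"
      using d(2)[OF p, of "point \<omega>" "point \<omega>'"] by (simp add: dist_real_def)
    moreover have "\<delta> \<le> d (\<omega> 0, \<omega>' 0)" unfolding \<delta>_def using fin p by (intro Min_le) auto
    ultimately show ?thesis by simp
  qed
  ultimately show thesis by (rule that)
qed

text \<open>
  A lower bound for the mutual distances of the first-level pieces, provided by compactness and strong separation.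
\<close>

definition gap :: real where
  "gap = (SOME \<delta>. \<delta> > 0 \<and> (\<forall>\<omega>\<in>digits. \<forall>\<omega>'\<in>digits. \<omega> 0 \<noteq> \<omega>' 0 \<longrightarrow> \<delta> \<le> \<bar>point \<omega> - point \<omega>'\<bar>))"

lemma gap: "gap > 0"
  "\<omega> \<in> digits \<Longrightarrow> \<omega>' \<in> digits \<Longrightarrow> \<omega> 0 \<noteq> \<omega>' 0 \<Longrightarrow> gap \<le> \<bar>point \<omega> - point \<omega>'\<bar>"
proof -
  have "gap > 0 \<and> (\<forall>\<omega>\<in>digits. \<forall>\<omega>'\<in>digits. \<omega> 0 \<noteq> \<omega>' 0 \<longrightarrow> gap \<le> \<bar>point \<omega> - point \<omega>'\<bar>)"
    unfolding gap_def by (rule someI_ex) (use separation_gap in metis)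
  then show "gap > 0"
    "\<omega> \<in> digits \<Longrightarrow> \<omega>' \<in> digits \<Longrightarrow> \<omega> 0 \<noteq> \<omega>' 0 \<Longrightarrow> gap \<le> \<bar>point \<omega> - point \<omega>'\<bar>" by auto
qed

text \<open>
  At the first disagreement \<open>k\<close> the shifted points lie in different first-level pieces, so the points are at least
  \<open>gap * \<rho> ^ k\<close> apart.
\<close>

lemma digits_agree_if_close:
  assumes w: "\<omega> \<in> digits" "\<omega>' \<in> digits" and close: "\<bar>point \<omega> - point \<omega>'\<bar> < gap * \<rho> ^ n" and "i \<le> n"
  shows "\<omega> i = \<omega>' i"
proof (rule ccontr)
  assume "\<omega> i \<noteq> \<omega>' i"
  then obtain k where k: "\<omega> k \<noteq> \<omega>' k" "k \<le> i" "\<And>j. j < k \<Longrightarrow> \<omega> j = \<omega>' j"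
    using exists_least_iff[of "\<lambda>k. \<omega> k \<noteq> \<omega>' k"] by (metis not_le)
  let ?z = "point (\<lambda>i. \<omega> (i + k)) - point (\<lambda>i. \<omega>' (i + k))"
  have "gap \<le> \<bar>?z\<bar>" using k(1) by (intro gap digits_shift w) simp
  then have "gap * \<rho> ^ k \<le> \<bar>\<rho> ^ k * ?z\<bar>"
    using rho by (simp add: abs_mult mult.commute)
  also have "\<rho> ^ k * ?z = point \<omega> - point \<omega>'" by (intro point_diff[symmetric] w k(3))
  finally have "gap * \<rho> ^ k \<le> \<bar>point \<omega> - point \<omega>'\<bar>" .
  moreover have "gap * \<rho> ^ n \<le> gap * \<rho> ^ k"
    using k(2) \<open>i \<le> n\<close> rho gap(1) by (intro mult_left_mono power_decreasing) auto
  ultimately show False using close by linarith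
qed

lemma point_inj: "\<omega> \<in> digits \<Longrightarrow> \<omega>' \<in> digits \<Longrightarrow> point \<omega> = point \<omega>' \<Longrightarrow> \<omega> = \<omega>'"
  using digits_agree_if_close[of \<omega> \<omega>'] gap(1) rho by (intro ext) auto

lemma coding_map_eq: 
  assumes "\<omega> \<in> digits"
  shows "coding_map \<rho> a \<omega> = point \<omega>"
  unfolding coding_map_def
proof (rule the_equality)
  show "point \<omega> \<in> (\<Inter>n\<in>{1..}. ifs_comp \<rho> a \<omega> n ` {0..1})"
    using point_split[OF assms] point_bounds[OF digits_shift[OF assms]] by fastforce
  fix x assume x: "x \<in> (\<Inter>n\<in>{1..}. ifs_comp \<rho> a \<omega> n ` {0..1})"
  show "x = point \<omega>"
  proof (rule eq_if_close)
    fix n :: nat assume "n \<ge> 1"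
    then have "x \<in> ifs_comp \<rho> a \<omega> n ` {0..1}" using x by blast
    then obtain y where y: "x = ifs_comp \<rho> a \<omega> n y" "0 \<le> y" "y \<le> 1" by auto
    have "\<bar>y - point (\<lambda>i. \<omega> (i + n))\<bar> \<le> 1"
      using point_bounds[OF digits_shift[OF assms, of n]] y by auto
    then show "\<bar>x - point \<omega>\<bar> \<le> \<rho> ^ n"
      using y(1) point_split[OF assms, of n] rho by (simp add: ifs_comp_diff abs_mult mult_left_le)
  qed
qed

lemma coding_point:
  assumes "\<omega> \<in> digits"
  shows "coding \<rho> a L (point \<omega>) = \<omega>"
  unfolding coding_def
proof (rule the_equality)
  have d: "\<omega> \<in> UNIV \<rightarrow> {1..L} \<longleftrightarrow> \<omega> \<in> digits" for \<omega> :: "nat \<Rightarrow> nat"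
    by (auto simp: digits_def simp del: atLeastAtMost_iff)
  show "\<omega> \<in> UNIV \<rightarrow> {1..L} \<and> coding_map \<rho> a \<omega> = point \<omega>"
    using assms by (simp only: d coding_map_eq)
  show "\<epsilon> = \<omega>" if "\<epsilon> \<in> UNIV \<rightarrow> {1..L} \<and> coding_map \<rho> a \<epsilon> = point \<omega>" for \<epsilon>
    using that assms unfolding d by (auto simp: coding_map_eq intro: point_inj)
qed

lemma shift_map_point: "\<omega> \<in> digits \<Longrightarrow> shift_map \<rho> a L (point \<omega>) = point (\<lambda>i. \<omega> (Suc i))"
  using coding_map_eq[OF digits_shift[of \<omega> 1]] by (simp add: shift_map_def coding_point)

lemma shift_map_funpow_point:
  "\<omega> \<in> digits \<Longrightarrow> (shift_map \<rho> a L ^^ n) (point \<omega>) = point (\<lambda>i. \<omega> (i + n))"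
proof (induction n)
  case (Suc n)
  then show ?case using shift_map_point[OF digits_shift[of \<omega> n]] by simp
qed simp

lemma recurrent_set_eq:
  "recurrent_set \<rho> a L K \<phi> =
    {point \<omega> | \<omega>. \<omega> \<in> digits \<and> infinite {n. 1 \<le> n \<and> \<bar>point (\<lambda>i. \<omega> (i + n)) - point \<omega>\<bar> < \<phi> n}}"
  unfolding recurrent_set_def K_eq_points by (auto simp: shift_map_funpow_point)

end

section \<open>Gauges and recurrence lengths\<close>

context self_similar_set
begin

lemma small_scale_exists:
  assumes "0 < (e::real)"
  obtains m where "\<And>n. m \<le> n \<Longrightarrow> \<rho> ^ n < e"
proof -
  obtain m where m: "\<rho> ^ m < e" using real_arch_pow_inv rho assms by blast
  have "\<rho> ^ n < e" if "m \<le> n" for n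
    using m power_decreasing[OF that, of \<rho>] rho by linarith
  then show thesis by (rule that)
qed

text \<open>
  A point of the cylinder of \<open>w\<close>; the digit \<open>1\<close> is an arbitrary continuation.
\<close>

definition word_center :: "nat list \<Rightarrow> real" where
  "word_center w = point (\<lambda>i. if i < length w then w ! i else 1)"

lemma word_center_in_K:
  assumes "w \<in> words L M"
  shows "(\<lambda>i. if i < length w then w ! i else 1) \<in> digits" "word_center w \<in> K"
proof -
  show "(\<lambda>i. if i < length w then w ! i else 1) \<in> digits"
    using words_nth[OF assms] words_length[OF assms] L2 unfolding digits_def by auto
  then show "word_center w \<in> K" unfolding word_center_def by (rule point_in_K)
qed

lemma digits_word: "\<omega> \<in> digits \<Longrightarrow> map \<omega> [0..<n] \<in> words L n"
  using digits_nth by (auto simp: words_def simp del: atLeastAtMost_iff)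

lemma point_near_word_center:
  assumes "\<omega> \<in> digits"
  shows "\<bar>word_center (map \<omega> [0..<n]) - point \<omega>\<bar> \<le> \<rho> ^ n"
  unfolding word_center_def
  by (rule point_close[OF word_center_in_K(1)[OF digits_word[OF assms, of n]] assms]) simp

lemma content_of_words_le:
  fixes f :: "real \<Rightarrow> real"
  assumes f_nonneg: "\<And>r. 0 < r \<Longrightarrow> 0 \<le> f r"
    and A: "A \<subseteq> K" "\<And>x. x \<in> A \<Longrightarrow> \<exists>\<omega>\<in>digits. x = point \<omega> \<and> map \<omega> [0..<M] \<in> V"
    and V: "V \<subseteq> words L M" and \<tau>: "2 * \<rho> ^ M \<le> \<tau>"
  shows "hausdorff_content K f \<tau> A \<le> ennreal (real (card V) * f (4 * \<rho> ^ M))"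
proof -
  have finV: "finite V" using V finite_subset by blast
  have "hausdorff_content K f \<tau> A \<le> (\<Sum>\<^sub>\<infinity>w\<in>V. ennreal (f (2 * (2 * \<rho> ^ M))))"
  proof (rule hausdorff_content_le_infsum[where x = word_center])
    show "\<exists>w\<in>V. dist (word_center w) y < 2 * \<rho> ^ M" if y: "y \<in> A" for y
    proof -
      obtain \<omega> where \<omega>: "\<omega> \<in> digits" "y = point \<omega>" "map \<omega> [0..<M] \<in> V" using A(2)[OF y] by blast
      have "\<rho> ^ M > 0" using rho by simp
      then have "dist (word_center (map \<omega> [0..<M])) y < 2 * \<rho> ^ M"
        using point_near_word_center[OF \<omega>(1), of M] unfolding \<omega>(2) dist_real_def by linarith
      then show ?thesis using \<omega>(3) by blast
    qed
  qed (use A V \<tau> rho word_center_in_K finV in \<open>auto intro: countable_finite\<close>)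
  also have "\<dots> = (\<Sum>w\<in>V. ennreal (f (4 * \<rho> ^ M)))" using finV by simp
  also have "\<dots> = ennreal (\<Sum>w\<in>V. f (4 * \<rho> ^ M))"
    using f_nonneg rho by (intro sum_ennreal) simp
  finally show ?thesis by simp
qed

end

text \<open>
  The parameter \<open>r0\<close> bounds the scales on which \<open>r powr (- \<gamma>) * f r\<close> is known to be monotone.
\<close>

locale self_similar_gauge = self_similar_set +
  fixes \<gamma> :: real and f :: "real \<Rightarrow> real" and r0 :: real
  assumes gamma: "\<gamma> = ln (real L) / (- ln \<rho>)"
    and dimf: "dimension_function f"
    and r0: "0 < r0" "antimono_on {0<..<r0} (\<lambda>r. r powr (- \<gamma>) * f r)"
begin

lemma f_pos: "r > 0 \<Longrightarrow> f r > 0"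
  using dimf by (simp add: dimension_function_def)

lemma f_mono: "0 < r \<Longrightarrow> r \<le> s \<Longrightarrow> f r \<le> f s"
  using dimf by (auto simp: dimension_function_def mono_on_def)

lemma rho_powr_gamma: "\<rho> powr (- \<gamma> * real n) = real L ^ n"
proof -
  have "- \<gamma> * real n * ln \<rho> = real n * ln (real L)"
    using rho by (simp add: gamma)
  then have "\<rho> powr (- \<gamma> * real n) = exp (real n * ln (real L))"
    using rho by (simp add: powr_def)
  also have "\<dots> = real L ^ n" using L2 by (simp add: exp_of_nat_mult)
  finally show ?thesis .
qed

abbreviation F :: "nat \<Rightarrow> real" where
  "F m \<equiv> f (\<rho> ^ m)"

lemma F_pos: "F m > 0"
  using rho by (intro f_pos) simp

lemma F_antimono: "m \<le> m' \<Longrightarrow> F m' \<le> F m"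
  using rho by (intro f_mono power_decreasing) auto

lemma F_tendsto_0: "F \<longlonglongrightarrow> 0"
proof -
  have "(\<lambda>n. \<rho> ^ n) \<longlonglongrightarrow> 0" using rho by (intro LIMSEQ_realpow_zero) auto
  then have "filterlim (\<lambda>n. \<rho> ^ n) (at_right 0) sequentially"
    using rho by (intro filterlim_atI[THEN filterlim_mono[OF _ order_refl order_refl]] tendsto_imp_filterlim_at_right) auto
  moreover have "(f \<longlongrightarrow> 0) (at_right 0)" using dimf by (simp add: dimension_function_def)
  ultimately show ?thesis using filterlim_compose by blast
qed

lemma ratio_antimono:
  "0 < r \<Longrightarrow> r \<le> s \<Longrightarrow> s < r0 \<Longrightarrow> s powr (- \<gamma>) * f s \<le> r powr (- \<gamma>) * f r"
  using r0(2) by (auto simp: monotone_on_def)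

lemma F_mult_power: "F m * real L ^ m = (\<rho> ^ m) powr (- \<gamma>) * f (\<rho> ^ m)"
proof -
  have "(\<rho> ^ m) powr (- \<gamma>) = \<rho> powr (- \<gamma> * real m)"
    using rho by (simp add: powr_realpow[symmetric] powr_powr mult.commute)
  then show ?thesis using rho_powr_gamma[of m] by simp
qed

text \<open>
  The ratio \<open>r powr (- \<gamma>) * f r\<close> at \<open>r = \<rho> ^ m\<close> is the cost of a cylinder relative to its uniform measure.
\<close>

lemma g_mono: "\<rho> ^ m < r0 \<Longrightarrow> m \<le> m' \<Longrightarrow> F m * real L ^ m \<le> F m' * real L ^ m'"
  unfolding F_mult_power using rho by (intro ratio_antimono power_decreasing) auto

lemma f_scale:
  assumes "1 \<le> c" "0 < r" "c * r < r0"
  shows "f (c * r) \<le> c powr \<gamma> * f r"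
proof -
  have le: "r \<le> c * r" using assms by simp
  have "(c * r) powr (- \<gamma>) * f (c * r) \<le> r powr (- \<gamma>) * f r"
    using assms le by (intro ratio_antimono) auto
  then have "(c * r) powr \<gamma> * ((c * r) powr (- \<gamma>) * f (c * r)) \<le> (c * r) powr \<gamma> * (r powr (- \<gamma>) * f r)"
    by (intro mult_left_mono) auto
  then show ?thesis using assms by (simp add: powr_mult powr_minus field_simps)
qed

text \<open>
  Take \<open>l n\<close> least with the first two properties. If \<open>l n > 0\<close>, then \<open>l n - 1\<close> violates one of them. A violation
  of the first bounds \<open>\<rho> ^ n * \<phi> n\<close> by \<open>\<rho> ^ (n + l n - 1)\<close>, and passing to the next level costs at most a
  factor \<open>L\<close>; a violation of the second bounds the new term below by \<open>1 / L\<close>. For \<open>l n = 0\<close> the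
  new term is a relative cost, bounded below by monotonicity. So each late new term dominates the old one up to the factor \<open>L\<close> or exceeds a
  positive constant.
\<close>

lemma truncated_recurrence_lengths:
  assumes phi: "\<And>n. 1 \<le> n \<Longrightarrow> 0 < \<phi> n"
    and div: "\<not> summable (\<lambda>n. f (\<rho> ^ n * \<phi> n) * real L ^ n)"
  obtains l where "\<And>n. 1 \<le> n \<Longrightarrow> \<rho> ^ l n < \<phi> n"
    "\<And>n. 1 \<le> n \<Longrightarrow> F (n + l n) * real L ^ n \<le> 1"
    "\<not> summable (\<lambda>n. F (n + l n) * real L ^ n)"
proof -
  let ?P = "\<lambda>n l. \<rho> ^ l < \<phi> n \<and> F (n + l) * real L ^ n \<le> 1"
  define l where "l n = (LEAST l. ?P n l)" for n
  have L0: "real L > 0" using L2 by simp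
  have ex: "\<exists>l. ?P n l" if n: "1 \<le> n" for n
  proof -
    obtain m where m: "\<And>k. m \<le> k \<Longrightarrow> \<rho> ^ k < \<phi> n" using small_scale_exists[OF phi[OF n]] by blast
    have "eventually (\<lambda>k. F k < 1 / real L ^ n) sequentially"
      using F_tendsto_0 L0 by (intro order_tendstoD) auto
    then obtain m' where m': "\<And>k. m' \<le> k \<Longrightarrow> F k < 1 / real L ^ n"
      by (auto simp: eventually_sequentially)
    have "F (n + (m + m')) * real L ^ n \<le> 1 / real L ^ n * real L ^ n"
      using m'[of "n + (m + m')"] by (intro mult_right_mono) auto
    then have "?P n (m + m')" using m[of "m + m'"] L0 by simp
    then show ?thesis by blast
  qed
  have l: "?P n (l n)" if "1 \<le> n" for n unfolding l_def by (rule LeastI_ex[OF ex[OF that]])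
  obtain m1 where m1: "\<And>n. m1 \<le> n \<Longrightarrow> \<rho> ^ n < r0" using small_scale_exists[OF r0(1)] by blast
  let ?s = "\<lambda>n. F (n + l n) * real L ^ n" and ?A = "\<lambda>n. f (\<rho> ^ n * \<phi> n) * real L ^ n"
  define c where "c = min (F m1 * real L ^ m1) (1 / real L)"
  have c0: "c > 0" using F_pos[of m1] L0 by (simp add: c_def)
  have step: "F m \<le> real L * F (Suc m)" if "m1 \<le> m" for m
  proof -
    have "F m * real L ^ m \<le> real L * F (Suc m) * real L ^ m"
      using g_mono[OF m1[OF that], of "Suc m"] by (simp add: ac_simps)
    then show ?thesis using L0 by (subst (asm) mult_le_cancel_right_pos) auto
  qed
  have dich: "?A n \<le> real L * ?s n \<or> c \<le> ?s n" if n: "max m1 1 \<le> n" for n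
  proof (cases "l n")
    case 0
    then show ?thesis using g_mono[OF m1[OF order_refl], of n] n by (simp add: c_def min_def)
  next
    case (Suc k)
    have F: "F (n + k) \<le> real L * F (n + l n)" using step[of "n + k"] n Suc by simp
    have "\<not> ?P n k" using not_less_Least[of k "?P n"] Suc by (simp add: l_def)
    then consider "\<phi> n \<le> \<rho> ^ k" | "1 < F (n + k) * real L ^ n" by (auto simp: not_less not_le)
    then show ?thesis
    proof cases
      case 1
      have "\<rho> ^ n * \<phi> n \<le> \<rho> ^ (n + k)" using 1 rho by (simp add: power_add)
      moreover have "0 < \<rho> ^ n * \<phi> n" using phi[of n] n rho by simp
      ultimately have "f (\<rho> ^ n * \<phi> n) \<le> F (n + k)" by (intro f_mono)
      then have "?A n \<le> real L * F (n + l n) * real L ^ n" using F by (intro mult_right_mono) auto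
      then show ?thesis by (simp add: mult.assoc)
    next
      case 2
      have "F (n + k) * real L ^ n \<le> real L * F (n + l n) * real L ^ n" using F by (intro mult_right_mono) auto
      then have "1 \<le> real L * ?s n" using 2 by (simp add: mult.assoc)
      then have "1 / real L \<le> ?s n" using L0 by (simp add: field_simps)
      then show ?thesis by (simp add: c_def min.coboundedI2)
    qed
  qed
  show thesis
  proof (rule that)
    show "\<not> summable ?s"
    proof
      assume s: "summable ?s"
      have "eventually (\<lambda>n. ?s n < c) sequentially"
        using summable_LIMSEQ_zero[OF s] c0 by (rule order_tendstoD)
      then obtain N where N: "\<And>n. N \<le> n \<Longrightarrow> ?s n < c" by (auto simp: eventually_sequentially)
      have "summable ?A"
      proof (rule summable_comparison_test[OF _ summable_mult[OF s, of "real L"]])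
        show "\<exists>N. \<forall>n\<ge>N. norm (?A n) \<le> real L * ?s n"
        proof (intro exI allI impI)
          fix n assume n: "max N (max m1 1) \<le> n"
          have "0 < \<rho> ^ n * \<phi> n" using phi[of n] n rho by simp
          then have "0 \<le> ?A n" using f_pos[of "\<rho> ^ n * \<phi> n"] by simp
          moreover have "?A n \<le> real L * ?s n" using dich[of n] N[of n] n by simp
          ultimately show "norm (?A n) \<le> real L * ?s n" by (simp only: real_norm_def abs_of_nonneg)
        qed
      qed
      then show False using div by blast
    qed
  qed (use l in auto)
qed

lemma recurrent_setI:
  assumes "\<omega> \<in> digits" "infinite {n. 1 \<le> n \<and> (\<forall>i<l n. \<omega> (n + i) = \<omega> i)}"
    and l: "\<And>n. 1 \<le> n \<Longrightarrow> \<rho> ^ l n < \<phi> n"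
  shows "point \<omega> \<in> recurrent_set \<rho> a L K \<phi>"
proof -
  have "{n. 1 \<le> n \<and> (\<forall>i<l n. \<omega> (n + i) = \<omega> i)} \<subseteq> {n. 1 \<le> n \<and> \<bar>point (\<lambda>i. \<omega> (i + n)) - point \<omega>\<bar> < \<phi> n}"
  proof
    fix n assume "n \<in> {n. 1 \<le> n \<and> (\<forall>i<l n. \<omega> (n + i) = \<omega> i)}"
    then have n: "1 \<le> n" "\<forall>i<l n. \<omega> (n + i) = \<omega> i" by auto
    have "\<bar>point (\<lambda>i. \<omega> (i + n)) - point \<omega>\<bar> \<le> \<rho> ^ l n"
      by (rule point_close[OF digits_shift[OF assms(1)] assms(1)]) (use n(2) in \<open>simp add: add.commute\<close>)
    then show "n \<in> {n. 1 \<le> n \<and> \<bar>point (\<lambda>i. \<omega> (i + n)) - point \<omega>\<bar> < \<phi> n}" using l[OF n(1)] n(1) by simp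
  qed
  then have "infinite {n. 1 \<le> n \<and> \<bar>point (\<lambda>i. \<omega> (i + n)) - point \<omega>\<bar> < \<phi> n}"
    using assms(2) finite_subset by blast
  then show ?thesis unfolding recurrent_set_eq using assms(1) by blast
qed

section \<open>Divergence with unbounded relative cost\<close>

text \<open>
  A ball of radius \<open>r\<close> lies in a cylinder of level \<open>k\<close> with \<open>\<rho> ^ k < 2 * r / (2 * gap * \<rho>)\<close>; the
  constant is the effect of this dilation on \<open>f\<close>.
\<close>

definition cover_const :: real where
  "cover_const = max 1 (1 / (2 * gap * \<rho>)) powr \<gamma>"

lemma cover_const_pos: "cover_const > 0"
  by (simp add: cover_const_def)

text \<open>
  Replaces a small ball by a cylinder containing it, at the price of a constant factor in the cost that is independent of
  the level \<open>m\<close> beyond which the cylinder must lie.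
\<close>

lemma cover_by_words:
  obtains \<tau> where "\<tau> > 0"
    "\<And>x r. x \<in> K \<Longrightarrow> 0 < r \<Longrightarrow> r \<le> \<tau> \<Longrightarrow> \<exists>w. w \<in> words L (length w) \<and> m < length w \<and>
       F (length w) \<le> cover_const * f (2 * r) \<and> (\<forall>\<omega>\<in>digits. \<bar>x - point \<omega>\<bar> < r \<longrightarrow> map \<omega> [0..<length w] = w)"
proof -
  define C where "C = max 1 (1 / (2 * gap * \<rho>))"
  have C1: "C \<ge> 1" by (simp add: C_def)
  define \<tau> where "\<tau> = min (gap * \<rho> ^ Suc m) (r0 / (4 * C))"
  have \<tau>0: "\<tau> > 0" using gap(1) rho r0(1) C1 by (simp add: \<tau>_def)
  show thesis
  proof (rule that[of \<tau>])
    fix x r assume x: "x \<in> K" and r: "0 < r" "r \<le> \<tau>"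
    obtain \<xi> where \<xi>: "\<xi> \<in> digits" "x = point \<xi>" using x K_eq_points by blast
    \<comment> \<open>The finest level at which separation keeps the ball inside one cylinder.\<close>
    define k where "k = (LEAST k. gap * \<rho> ^ Suc k < r)"
    have "\<exists>k. gap * \<rho> ^ Suc k < r"
    proof -
      obtain k where "\<And>n. k \<le> n \<Longrightarrow> \<rho> ^ n < r / gap" using small_scale_exists[of "r / gap"] r gap(1) by auto
      from this[of "Suc k"] show ?thesis using gap(1) by (intro exI[of _ k]) (simp add: field_simps)
    qed
    then have k: "gap * \<rho> ^ Suc k < r" unfolding k_def by (rule LeastI_ex)
    have "m < k"
    proof (rule ccontr)
      assume "\<not> m < k"
      then have "\<rho> ^ Suc m \<le> \<rho> ^ Suc k" using rho by (intro power_decreasing) auto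
      then have "gap * \<rho> ^ Suc m \<le> gap * \<rho> ^ Suc k" using gap(1) by (intro mult_left_mono) auto
      then show False using k r by (simp add: \<tau>_def)
    qed
    then obtain j where j: "k = Suc j" by (cases k) auto
    have rk: "r \<le> gap * \<rho> ^ k"
      using not_less_Least[of j "\<lambda>k. gap * \<rho> ^ Suc k < r"] unfolding k_def[symmetric] j by simp
    define w where "w = map \<xi> [0..<k]"
    have len: "length w = k" by (simp add: w_def)
    have "\<rho> ^ k \<le> C * (2 * r)"
    proof -
      have "\<rho> ^ k \<le> 1 / (2 * gap * \<rho>) * (2 * r)" using k gap(1) rho by (simp add: field_simps)
      also have "\<dots> \<le> C * (2 * r)" using r by (intro mult_right_mono) (auto simp: C_def)
      finally show ?thesis .
    qed
    then have "F k \<le> f (C * (2 * r))" using rho by (intro f_mono) auto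
    also have "\<dots> \<le> cover_const * f (2 * r)"
      unfolding cover_const_def C_def[symmetric]
    proof (rule f_scale[OF C1])
      have "r \<le> r0 / (4 * C)" using r by (simp add: \<tau>_def)
      then have "C * (2 * r) \<le> r0 / 2" using C1 by (simp add: field_simps)
      then show "C * (2 * r) < r0" using r0(1) by simp
    qed (use r in auto)
    finally have "F (length w) \<le> cover_const * f (2 * r)" by (simp add: len)
    moreover have "map \<omega> [0..<length w] = w" if "\<omega> \<in> digits" "\<bar>x - point \<omega>\<bar> < r" for \<omega>
    proof -
      have "\<bar>point \<xi> - point \<omega>\<bar> < gap * \<rho> ^ k" using that(2) rk \<xi>(2) by simp
      then have "\<xi> i = \<omega> i" if "i \<le> k" for i
        using digits_agree_if_close[OF \<xi>(1) \<open>\<omega> \<in> digits\<close>] that by blast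
      then show ?thesis by (simp add: w_def)
    qed
    ultimately show "\<exists>w. w \<in> words L (length w) \<and> m < length w \<and>
       F (length w) \<le> cover_const * f (2 * r) \<and> (\<forall>\<omega>\<in>digits. \<bar>x - point \<omega>\<bar> < r \<longrightarrow> map \<omega> [0..<length w] = w)"
      using digits_word[OF \<xi>(1), of k] \<open>m < k\<close> len by (intro exI[of _ w]) (auto simp: w_def)
  qed (use C1 \<tau>0 in auto)
qed

text \<open>
  A cover witnessing finite measure would translate into a cover by cylinders of bounded cost and arbitrarily
  fine level, contradicting \<open>recurrent_point_outside_cheap_cover\<close>.
\<close>

lemma measure_recurrent_set_infinite:
  assumes phi: "\<And>n. 1 \<le> n \<Longrightarrow> 0 < \<phi> n"
    and div: "\<not> summable (\<lambda>n. f (\<rho> ^ n * \<phi> n) * real L ^ n)"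
    and unbounded: "\<And>y m. \<exists>m'\<ge>m. y \<le> F m' * real L ^ m'"
  shows "hausdorff_measure K f (recurrent_set \<rho> a L K \<phi>) = \<infinity>"
proof (rule ccontr)
  let ?R = "recurrent_set \<rho> a L K \<phi>"
  assume "hausdorff_measure K f ?R \<noteq> \<infinity>"
  then obtain h where h: "h \<ge> 0" "hausdorff_measure K f ?R = ennreal h"
    by (cases "hausdorff_measure K f ?R") auto
  obtain l where l: "\<And>n. 1 \<le> n \<Longrightarrow> \<rho> ^ l n < \<phi> n"
    "\<And>n. 1 \<le> n \<Longrightarrow> F (n + l n) * real L ^ n \<le> 1"
    "\<not> summable (\<lambda>n. F (n + l n) * real L ^ n)"
    using truncated_recurrence_lengths[OF phi div] by blast
  obtain mr where mr: "\<And>n. mr \<le> n \<Longrightarrow> \<rho> ^ n < r0" using small_scale_exists[OF r0(1)] by blast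
  obtain m1 where m1: "mr \<le> m1" "1 \<le> F m1 * real L ^ m1" using unbounded by blast
  interpret recurrence_gauge L F l m1
  proof
    show "1 \<le> F m * real L ^ m" if "m1 \<le> m" for m
      using g_mono[OF mr[OF m1(1)] that] m1(2) by simp
    show "F m * real L ^ m \<le> F m' * real L ^ m'" if "m1 \<le> m" "m \<le> m'" for m m'
      using that m1(1) by (intro g_mono mr) auto
  qed (use L2 F_pos F_antimono unbounded l in auto)
  define H where "H = cover_const * (h + 1)"
  obtain m where m: "\<forall>C. (\<forall>c\<in>C. c \<in> words L (length c) \<and> m < length c) \<longrightarrow>
      (\<lambda>c. F (length c)) summable_on C \<longrightarrow> infsum (\<lambda>c. F (length c)) C \<le> H \<longrightarrow>
      (\<exists>\<omega>. range \<omega> \<subseteq> {1..L} \<and> infinite {n. 1 \<le> n \<and> (\<forall>i<l n. \<omega> (n + i) = \<omega> i)} \<and>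
        (\<forall>c\<in>C. map \<omega> [0..<length c] \<noteq> c))"
    using recurrent_point_outside_cheap_cover[of H] ..
  obtain \<tau> where \<tau>: "\<tau> > 0"
    "\<And>x r. x \<in> K \<Longrightarrow> 0 < r \<Longrightarrow> r \<le> \<tau> \<Longrightarrow> \<exists>w. w \<in> words L (length w) \<and> m < length w \<and>
       F (length w) \<le> cover_const * f (2 * r) \<and> (\<forall>\<omega>\<in>digits. \<bar>x - point \<omega>\<bar> < r \<longrightarrow> map \<omega> [0..<length w] = w)"
    using cover_by_words[of m] by blast
  have "hausdorff_content K f \<tau> ?R \<le> ennreal h"
    using hausdorff_content_le_measure[OF \<tau>(1), of K f ?R] h(2) by simp
  also have "\<dots> < ennreal (h + 1)" using h(1) by (intro ennreal_lessI) auto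
  finally obtain I x r where cover: "hausdorff_cover K \<tau> ?R I x r"
    and cost: "(\<Sum>\<^sub>\<infinity>i\<in>I. ennreal (f (2 * r i))) < ennreal (h + 1)"
    by (rule hausdorff_content_cover)
  have xr: "x i \<in> K" "0 < r i" "r i \<le> \<tau>" if "i \<in> I" for i
    using cover that by (auto simp: hausdorff_cover_def)
  have "\<forall>i\<in>I. \<exists>w. w \<in> words L (length w) \<and> m < length w \<and>
       F (length w) \<le> cover_const * f (2 * r i) \<and>
       (\<forall>\<omega>\<in>digits. \<bar>x i - point \<omega>\<bar> < r i \<longrightarrow> map \<omega> [0..<length w] = w)"
    using \<tau>(2) xr by blast
  from bchoice[OF this] obtain w where w: "\<forall>i\<in>I. w i \<in> words L (length (w i)) \<and> m < length (w i) \<and>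
       F (length (w i)) \<le> cover_const * f (2 * r i) \<and>
       (\<forall>\<omega>\<in>digits. \<bar>x i - point \<omega>\<bar> < r i \<longrightarrow> map \<omega> [0..<length (w i)] = w i)" ..
  have bound: "(\<Sum>c\<in>P. F (length c)) \<le> H" if P: "finite P" "P \<subseteq> w ` I" for P
  proof -
    obtain U where U: "U \<subseteq> I" "inj_on w U" "P = w ` U" using P(2) unfolding subset_image_inj by blast
    then have finU: "finite U" using P(1) finite_imageD by blast
    have f0: "f (2 * r i) \<ge> 0" if "i \<in> U" for i using f_pos[of "2 * r i"] xr(2)[of i] that U(1) by auto
    have "ennreal (\<Sum>i\<in>U. f (2 * r i)) = (\<Sum>i\<in>U. ennreal (f (2 * r i)))"
      using f0 by (rule sum_ennreal[symmetric])
    also have "\<dots> \<le> (\<Sum>\<^sub>\<infinity>i\<in>I. ennreal (f (2 * r i)))" by (rule sum_le_infsum_ennreal[OF finU U(1)])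
    also have "\<dots> \<le> ennreal (h + 1)" using cost by simp
    finally have le: "(\<Sum>i\<in>U. f (2 * r i)) \<le> h + 1" using h(1) by (subst (asm) ennreal_le_iff) auto
    have "(\<Sum>c\<in>P. F (length c)) = (\<Sum>i\<in>U. F (length (w i)))" by (simp add: U(2,3) sum.reindex)
    also have "\<dots> \<le> (\<Sum>i\<in>U. cover_const * f (2 * r i))" using w U(1) by (intro sum_mono) blast
    also have "\<dots> = cover_const * (\<Sum>i\<in>U. f (2 * r i))" by (rule sum_distrib_left[symmetric])
    also have "\<dots> \<le> H" unfolding H_def using cover_const_pos le by (intro mult_left_mono) auto
    finally show ?thesis .
  qed
  have summ: "(\<lambda>c. F (length c)) summable_on w ` I"
    using F_pos bound by (intro nonneg_bdd_above_summable_on bdd_aboveI[of _ H]) (auto intro: less_imp_le)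
  then have le: "infsum (\<lambda>c. F (length c)) (w ` I) \<le> H"
    using bound by (intro infsum_le_finite_sums) auto
  have "\<forall>c\<in>w ` I. c \<in> words L (length c) \<and> m < length c" using w by blast
  from m[THEN spec, THEN mp, THEN mp, THEN mp, OF this summ le] obtain \<omega> where \<omega>: "range \<omega> \<subseteq> {1..L}" "infinite {n. 1 \<le> n \<and> (\<forall>i<l n. \<omega> (n + i) = \<omega> i)}"
    "\<forall>c\<in>w ` I. map \<omega> [0..<length c] \<noteq> c"
    by blast
  have d: "\<omega> \<in> digits" using \<omega>(1) by (simp add: digits_def)
  have "point \<omega> \<in> ?R" by (rule recurrent_setI[OF d \<omega>(2) l(1)])
  then obtain i where i: "i \<in> I" "point \<omega> \<in> ball (x i) (r i)"
    using cover unfolding hausdorff_cover_def by blast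
  then have "map \<omega> [0..<length (w i)] = w i" using w d by (simp add: dist_real_def)
  then show False using \<omega>(3) i(1) by blast
qed

section \<open>Divergence with bounded relative cost\<close>

text \<open>
  Dividing \<open>F (n + l n) * L ^ n\<close> by the bound \<open>G\<close> shows that \<open>1 / L ^ l n\<close> is not summable. So for every \<open>k\<close> the points
  without recurrence after time \<open>k\<close> lie in an arbitrarily small proportion of the cylinders of some level \<open>M\<close>, and
  these cylinders cost at most a constant times \<open>1 / L ^ M\<close> each.
\<close>

lemma measure_recurrent_set_full:
  assumes phi: "\<And>n. 1 \<le> n \<Longrightarrow> 0 < \<phi> n"
    and div: "\<not> summable (\<lambda>n. f (\<rho> ^ n * \<phi> n) * real L ^ n)"
    and bounded: "\<And>m'. m \<le> m' \<Longrightarrow> F m' * real L ^ m' \<le> G"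
  shows "hausdorff_measure K f (recurrent_set \<rho> a L K \<phi>) = hausdorff_measure K f K"
proof -
  let ?R = "recurrent_set \<rho> a L K \<phi>"
  obtain l where l: "\<And>n. 1 \<le> n \<Longrightarrow> \<rho> ^ l n < \<phi> n"
    "\<And>n. 1 \<le> n \<Longrightarrow> F (n + l n) * real L ^ n \<le> 1"
    "\<not> summable (\<lambda>n. F (n + l n) * real L ^ n)"
    using truncated_recurrence_lengths[OF phi div] by blast
  have L0: "real L > 0" using L2 by simp
  have G0: "G > 0" using bounded[OF order_refl] F_pos[of m] L0
    by (meson less_le_trans mult_pos_pos zero_less_power)
  have div': "\<not> summable (\<lambda>n. 1 / real L ^ l n)"
  proof
    assume "summable (\<lambda>n. 1 / real L ^ l n)"
    then have "summable (\<lambda>n. G * (1 / real L ^ l n))" by (rule summable_mult)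
    then have "summable (\<lambda>n. F (n + l n) * real L ^ n)"
    proof (rule summable_comparison_test[rotated], intro exI allI impI)
      fix n assume n: "m \<le> n"
      have "F (n + l n) * real L ^ n = F (n + l n) * real L ^ (n + l n) * (1 / real L ^ l n)"
        using L0 by (simp add: power_add)
      also have "\<dots> \<le> G * (1 / real L ^ l n)" using bounded[of "n + l n"] n by (intro mult_right_mono) auto
      finally show "norm (F (n + l n) * real L ^ n) \<le> G * (1 / real L ^ l n)"
        using F_pos[of "n + l n"] by simp
    qed
    then show False using l(3) by blast
  qed
  \<comment> \<open>\<open>Suc k\<close> keeps the time \<open>0\<close> out: a word recurs trivially after no steps.\<close>
  define N where "N k = {point \<omega> | \<omega>. \<omega> \<in> digits \<and> (\<forall>n\<ge>Suc k. \<not> (\<forall>i<l n. \<omega> (n + i) = \<omega> i))}" for k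
  have NK: "N k \<subseteq> K" for k using point_in_K by (auto simp: N_def)
  have RK: "?R \<subseteq> K" by (auto simp: recurrent_set_def)
  have sub: "K \<subseteq> ?R \<union> (\<Union>k. N k)"
  proof
    fix x assume "x \<in> K"
    then obtain \<omega> where \<omega>: "\<omega> \<in> digits" "x = point \<omega>" using K_eq_points by blast
    show "x \<in> ?R \<union> (\<Union>k. N k)"
    proof (cases "infinite {n. 1 \<le> n \<and> (\<forall>i<l n. \<omega> (n + i) = \<omega> i)}")
      case True
      then show ?thesis using recurrent_setI[OF \<omega>(1) True l(1)] \<omega>(2) by simp
    next
      case False
      then have "finite {n. 1 \<le> n \<and> (\<forall>i<l n. \<omega> (n + i) = \<omega> i)}" by simp
      then obtain k where k: "\<forall>n\<in>{n. 1 \<le> n \<and> (\<forall>i<l n. \<omega> (n + i) = \<omega> i)}. n \<le> k"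
        unfolding finite_nat_set_iff_bounded_le ..
      have "\<not> (\<forall>i<l n. \<omega> (n + i) = \<omega> i)" if "Suc k \<le> n" for n
      proof
        assume "\<forall>i<l n. \<omega> (n + i) = \<omega> i"
        then have "n \<le> k" using k that by auto
        then show False using that by simp
      qed
      then have "x \<in> N k" unfolding N_def using \<omega> by blast
      then show ?thesis by blast
    qed
  qed
  have null: "hausdorff_measure K f (N k) = 0" for k
  proof -
    have "hausdorff_content K f \<tau> (N k) \<le> 0" if \<tau>: "\<tau> > 0" for \<tau>
    proof (rule ennreal_le_epsilon)
      fix e :: real assume e: "0 < e"
      define \<delta> where "\<delta> = e / (4 powr \<gamma> * G)"
      have \<delta>: "\<delta> > 0" using e G0 by (simp add: \<delta>_def)
      obtain N' where N': "\<And>M. (\<And>n. n \<in> {Suc k..N'} \<Longrightarrow> n + l n \<le> M) \<Longrightarrow>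
          real (card {v \<in> words L M. \<forall>n\<in>{Suc k..N'}. \<not> recurs n (l n) v}) \<le> \<delta> * real L ^ M"
        using almost_all_words_recur[OF L2 div' \<delta>, of "Suc k"] by auto
      obtain m2 where m2: "\<And>n. m2 \<le> n \<Longrightarrow> \<rho> ^ n < min (\<tau> / 2) (r0 / 4)"
        using small_scale_exists[of "min (\<tau> / 2) (r0 / 4)"] \<tau> r0(1) by auto
      define M where "M = m + m2 + (\<Sum>n\<in>{Suc k..N'}. n + l n)"
      have M: "n + l n \<le> M" if "n \<in> {Suc k..N'}" for n
        using member_le_sum[of n "{Suc k..N'}" "\<lambda>n. n + l n"] that by (simp add: M_def)
      have small: "\<rho> ^ M < \<tau> / 2" "\<rho> ^ M < r0 / 4" using m2[of M] by (auto simp: M_def)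
      let ?V = "{v \<in> words L M. \<forall>n\<in>{Suc k..N'}. \<not> recurs n (l n) v}"
      have "hausdorff_content K f \<tau> (N k) \<le> ennreal (real (card ?V) * f (4 * \<rho> ^ M))"
      proof (rule content_of_words_le[OF _ NK])
        fix x assume "x \<in> N k"
        then obtain \<omega> where \<omega>: "\<omega> \<in> digits" "x = point \<omega>"
          "\<And>n. Suc k \<le> n \<Longrightarrow> \<not> (\<forall>i<l n. \<omega> (n + i) = \<omega> i)"
          by (auto simp: N_def)
        have "\<not> recurs n (l n) (map \<omega> [0..<M])" if n: "n \<in> {Suc k..N'}" for n
          using \<omega>(3)[of n] M[OF n] n by (auto simp: recurs_def)
        then show "\<exists>\<omega>\<in>digits. x = point \<omega> \<and> map \<omega> [0..<M] \<in> ?V"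
          using \<omega> digits_word[OF \<omega>(1), of M] by blast
      qed (use small f_pos in \<open>auto intro: less_imp_le\<close>)
      also have "real (card ?V) * f (4 * \<rho> ^ M) \<le> \<delta> * real L ^ M * (4 powr \<gamma> * F M)"
        using small rho \<delta> f_pos[of "4 * \<rho> ^ M"]
        by (intro mult_mono N' M f_scale) (auto intro: less_imp_le)
      also have "\<dots> = \<delta> * 4 powr \<gamma> * (F M * real L ^ M)" by simp
      also have "\<dots> \<le> \<delta> * 4 powr \<gamma> * G"
        using bounded[of M] \<delta> by (intro mult_left_mono) (auto simp: M_def)
      also have "\<dots> = e" using G0 by (simp add: \<delta>_def)
      finally show "hausdorff_content K f \<tau> (N k) \<le> 0 + ennreal e"
        by (simp add: ennreal_leI)
    qed
    then have "hausdorff_measure K f (N k) \<le> 0" by (rule hausdorff_measure_leI)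
    then show ?thesis by simp
  qed
  have "hausdorff_measure K f K \<le> hausdorff_measure K f (?R \<union> (\<Union>k. N k))"
    by (rule hausdorff_measure_mono[OF sub])
  also have "\<dots> \<le> hausdorff_measure K f ?R"
    using NK RK by (intro hausdorff_measure_Un_null hausdorff_measure_UN_null null) auto
  finally show ?thesis using hausdorff_measure_mono[OF RK] by (intro antisym)
qed

section \<open>Convergence\<close>

text \<open>
  If \<open>x\<close> has \<open>n\<close>-digit prefix \<open>w\<close> and \<open>p\<close> is the point with the periodic coding \<open>w w w \<dots>\<close>, then
  \<open>x - p = \<rho> ^ n * (T\<^sup>n x - p)\<close>, hence \<open>\<bar>T\<^sup>n x - x\<bar> = (1 - \<rho> ^ n) * \<bar>T\<^sup>n x - p\<bar>\<close>. This locates \<open>x\<close> within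
  \<open>\<rho> ^ n * \<phi> n / (1 - \<rho>)\<close> of \<open>p\<close>.
\<close>

lemma measure_recurrent_set_null:
  assumes phi: "\<And>n. 1 \<le> n \<Longrightarrow> 0 < \<phi> n"
    and conv: "summable (\<lambda>n. f (\<rho> ^ n * \<phi> n) * real L ^ n)"
  shows "hausdorff_measure K f (recurrent_set \<rho> a L K \<phi>) = 0"
proof -
  let ?R = "recurrent_set \<rho> a L K \<phi>" and ?A = "\<lambda>n. f (\<rho> ^ n * \<phi> n) * real L ^ n"
  \<comment> \<open>The cost of a ball is \<open>f\<close> at twice its radius, hence the factor \<open>2\<close>.\<close>
  define C where "C = 2 / (1 - \<rho>)"
  have C: "C \<ge> 1" using rho by (simp add: C_def field_simps)
  define rad where "rad n = \<rho> ^ n * \<phi> n / (1 - \<rho>)" for n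
  have L0: "real L > 0" using L2 by simp
  have pos: "0 < \<rho> ^ n * \<phi> n" if "1 \<le> n" for n using phi[OF that] rho by simp
  have tail_small: "\<exists>m1. \<forall>n\<ge>m1. 1 \<le> n \<longrightarrow> \<rho> ^ n * \<phi> n < e" if e: "e > 0" for e
  proof -
    have "eventually (\<lambda>n. ?A n < f e) sequentially"
      using summable_LIMSEQ_zero[OF conv] f_pos[OF e] by (rule order_tendstoD)
    then obtain m1 where m1: "\<And>n. m1 \<le> n \<Longrightarrow> ?A n < f e" by (auto simp: eventually_sequentially)
    have "\<rho> ^ n * \<phi> n < e" if n: "m1 \<le> n" "1 \<le> n" for n
    proof (rule ccontr)
      assume "\<not> \<rho> ^ n * \<phi> n < e"
      then have "f e \<le> f (\<rho> ^ n * \<phi> n)" using e by (intro f_mono) auto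
      also have "\<dots> \<le> ?A n" using f_pos[OF pos[OF n(2)]] L2 by simp
      finally show False using m1[OF n(1)] by simp
    qed
    then show ?thesis by blast
  qed
  define center where "center w = point (\<lambda>i. w ! (i mod length w))" for w :: "nat list"
  have per_digits: "(\<lambda>i. w ! (i mod length w)) \<in> digits" if "w \<in> words L n" "1 \<le> n" for w n
  proof -
    have "w ! (i mod length w) \<in> {1..L}" for i
      using words_nth[OF that(1), of "i mod length w"] words_length[OF that(1)] that(2) by simp
    then show ?thesis unfolding digits_def by blast
  qed
  have near: "\<bar>center (map \<omega> [0..<n]) - point \<omega>\<bar> < rad n"
    if \<omega>: "\<omega> \<in> digits" "1 \<le> n" "\<bar>point (\<lambda>i. \<omega> (i + n)) - point \<omega>\<bar> < \<phi> n" for \<omega> n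
  proof -
    let ?p = "\<lambda>i. map \<omega> [0..<n] ! (i mod n)"
    have pd: "?p \<in> digits" using per_digits[OF digits_word[OF \<omega>(1)] \<omega>(2)] by simp
    have c: "center (map \<omega> [0..<n]) = point ?p" by (simp add: center_def)
    have "point \<omega> - point ?p = \<rho> ^ n * (point (\<lambda>i. \<omega> (i + n)) - point (\<lambda>i. ?p (i + n)))"
      by (rule point_diff[OF \<omega>(1) pd]) simp
    then have eq: "point \<omega> - point ?p = \<rho> ^ n * (point (\<lambda>i. \<omega> (i + n)) - point ?p)" by simp
    define u v where "u = point \<omega> - point ?p" and "v = point (\<lambda>i. \<omega> (i + n)) - point ?p"
    have rn: "\<rho> ^ n \<le> \<rho>" using power_decreasing[of 1 n \<rho>] \<omega>(2) rho by simp
    have "(1 - \<rho>) * \<bar>v\<bar> \<le> (1 - \<rho> ^ n) * \<bar>v\<bar>" using rn by (intro mult_right_mono) auto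
    also have "\<dots> = \<bar>v - u\<bar>"
    proof -
      have "v - u = (1 - \<rho> ^ n) * v" using eq by (simp add: u_def v_def algebra_simps)
      then show ?thesis using rn rho by (simp add: abs_mult)
    qed
    also have "\<dots> < \<phi> n" using \<omega>(3) by (simp add: u_def v_def)
    finally have "\<bar>v\<bar> < \<phi> n / (1 - \<rho>)" using rho by (simp add: field_simps)
    then have "\<rho> ^ n * \<bar>v\<bar> < \<rho> ^ n * (\<phi> n / (1 - \<rho>))" using rho by (intro mult_strict_left_mono) auto
    moreover have "\<bar>u\<bar> = \<rho> ^ n * \<bar>v\<bar>" using eq rho by (simp add: u_def v_def abs_mult)
    ultimately show ?thesis unfolding c rad_def by (simp add: u_def abs_minus_commute)
  qed
  have "hausdorff_content K f \<tau> ?R \<le> 0" if \<tau>: "\<tau> > 0" for \<tau>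
  proof (rule ennreal_le_epsilon)
    fix e :: real assume e: "0 < e"
    obtain m1 where m1: "\<And>n. m1 \<le> n \<Longrightarrow> 1 \<le> n \<Longrightarrow> \<rho> ^ n * \<phi> n < min (r0 / C) (\<tau> / C)"
      using tail_small[of "min (r0 / C) (\<tau> / C)"] r0(1) \<tau> C by auto
    have "eventually (\<lambda>n. norm (\<Sum>i. ?A (i + n)) < e / C powr \<gamma>) sequentially"
      using suminf_exist_split[OF _ conv, of "e / C powr \<gamma>"] e C by (auto simp: eventually_sequentially)
    then obtain m2 where m2: "\<And>n. m2 \<le> n \<Longrightarrow> norm (\<Sum>i. ?A (i + n)) < e / C powr \<gamma>"
      by (auto simp: eventually_sequentially)
    define k where "k = max 1 (max m1 m2)"
    have k: "1 \<le> k" "m1 \<le> k" "m2 \<le> k" by (auto simp: k_def)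
    let ?J = "SIGMA n:{k..}. words L n"
    have rad: "0 < rad n" "rad n \<le> \<tau>" "f (2 * rad n) \<le> C powr \<gamma> * f (\<rho> ^ n * \<phi> n)" if n: "n \<ge> k" for n
    proof -
      have p: "0 < \<rho> ^ n * \<phi> n" using pos[of n] n k by simp
      have lt: "C * (\<rho> ^ n * \<phi> n) < r0" "C * (\<rho> ^ n * \<phi> n) < \<tau>"
        using m1[of n] n k C by (auto simp: field_simps)
      show "0 < rad n" unfolding rad_def using p rho by simp
      have eq: "2 * rad n = C * (\<rho> ^ n * \<phi> n)" by (simp add: rad_def C_def)
      then show "rad n \<le> \<tau>" using lt(2) \<open>0 < rad n\<close> by linarith
      show "f (2 * rad n) \<le> C powr \<gamma> * f (\<rho> ^ n * \<phi> n)" unfolding eq by (rule f_scale[OF C p lt(1)])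
    qed
    have "hausdorff_content K f \<tau> ?R \<le> (\<Sum>\<^sub>\<infinity>p\<in>?J. ennreal (f (2 * rad (fst p))))"
    proof (rule hausdorff_content_le_infsum[where x = "\<lambda>p. center (snd p)"])
      show "countable ?J" by (intro countable_SIGMA countable_finite[OF finite_words]) auto
      show "center (snd p) \<in> K \<and> 0 < rad (fst p) \<and> rad (fst p) \<le> \<tau>" if "p \<in> ?J" for p
        using that rad k point_in_K[OF per_digits[of "snd p" "fst p"]] by (auto simp: center_def)
      show "\<exists>p\<in>?J. dist (center (snd p)) y < rad (fst p)" if y: "y \<in> ?R" for y
      proof -
        obtain \<omega> where \<omega>: "\<omega> \<in> digits" "y = point \<omega>"
          "infinite {n. 1 \<le> n \<and> \<bar>point (\<lambda>i. \<omega> (i + n)) - point \<omega>\<bar> < \<phi> n}"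
          using y unfolding recurrent_set_eq by blast
        obtain n where n: "k < n" "1 \<le> n" "\<bar>point (\<lambda>i. \<omega> (i + n)) - point \<omega>\<bar> < \<phi> n"
          using \<omega>(3) unfolding infinite_nat_iff_unbounded by blast
        show ?thesis
          using near[OF \<omega>(1) n(2,3)] n(1) digits_word[OF \<omega>(1), of n]
          by (intro bexI[of _ "(n, map \<omega> [0..<n])"]) (auto simp: dist_real_def \<omega>(2))
      qed
    qed (auto simp: recurrent_set_def)
    also have "\<dots> \<le> ennreal e"
    proof (rule infsum_ennreal_le)
      fix P assume P: "finite P" "P \<subseteq> ?J"
      define Q where "Q = fst ` P"
      have finQ: "finite Q" "\<And>n. n \<in> Q \<Longrightarrow> k \<le> n" using P by (auto simp: Q_def)
      have PQ: "P \<subseteq> (SIGMA n:Q. words L n)" using P(2) by (force simp: Q_def)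
      have A0: "0 \<le> ?A n" if "k \<le> n" for n using f_pos[OF pos[of n]] that k by simp
      have f0: "0 \<le> f (2 * rad n)" if "k \<le> n" for n using f_pos[of "2 * rad n"] rad(1)[OF that] by simp
      have "(\<Sum>p\<in>P. ennreal (f (2 * rad (fst p)))) = ennreal (\<Sum>p\<in>P. f (2 * rad (fst p)))"
        using P(2) f0 by (intro sum_ennreal) auto
      also have "(\<Sum>p\<in>P. f (2 * rad (fst p))) \<le> (\<Sum>p\<in>(SIGMA n:Q. words L n). f (2 * rad (fst p)))"
        using PQ finQ f0 by (intro sum_mono2 finite_SigmaI finite_words) auto
      also have "\<dots> = (\<Sum>n\<in>Q. \<Sum>v\<in>words L n. f (2 * rad n))"
        using finQ by (subst sum.Sigma) (auto intro!: sum.cong)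
      also have "\<dots> = (\<Sum>n\<in>Q. real L ^ n * f (2 * rad n))" by (simp add: card_words)
      also have "\<dots> \<le> (\<Sum>n\<in>Q. real L ^ n * (C powr \<gamma> * f (\<rho> ^ n * \<phi> n)))"
        using finQ rad(3) by (intro sum_mono mult_left_mono) auto
      also have "\<dots> = C powr \<gamma> * (\<Sum>n\<in>Q. ?A n)" unfolding sum_distrib_left by (simp add: ac_simps)
      also have "(\<Sum>n\<in>Q. ?A n) = (\<Sum>i\<in>(\<lambda>n. n - k) ` Q. ?A (i + k))"
        by (rule sum.reindex_bij_witness[of _ "\<lambda>i. i + k" "\<lambda>n. n - k"]) (use finQ in auto)
      also have "\<dots> \<le> (\<Sum>i. ?A (i + k))"
        using finQ conv A0 by (intro sum_le_suminf summable_ignore_initial_segment) auto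
      also have "\<dots> \<le> e / C powr \<gamma>" using m2[OF k(3)] by simp
      also have "C powr \<gamma> * (e / C powr \<gamma>) = e" using C by simp
      finally show "(\<Sum>p\<in>P. ennreal (f (2 * rad (fst p)))) \<le> ennreal e"
        by (simp add: ennreal_leI mult_left_mono)
    qed
    finally show "hausdorff_content K f \<tau> ?R \<le> 0 + ennreal e" by simp
  qed
  then have "hausdorff_measure K f ?R \<le> 0" by (rule hausdorff_measure_leI)
  then show ?thesis by simp
qed

end

section \<open>The dimension of the attractor\<close>

context self_similar_set
begin

lemma power_gauge:
  assumes "\<gamma> = ln (real L) / (- ln \<rho>)" "0 < s" "s < \<gamma>"
  shows "self_similar_gauge L \<rho> a K \<gamma> (\<lambda>r. r powr s) 1"
proof
  show "dimension_function (\<lambda>r. r powr s)"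
    unfolding dimension_function_def
  proof (intro conjI)
    show "continuous_on {0<..} (\<lambda>r. r powr s)" by (intro continuous_intros) auto
    show "mono_on {0<..} (\<lambda>r. r powr s)" using assms(2) by (auto intro!: mono_onI powr_mono2)
    have "((\<lambda>r. r powr s) \<longlongrightarrow> 0 powr s) (at_right 0)"
      using assms(2) by (intro tendsto_powr' tendsto_ident_at tendsto_const)
        (auto simp: eventually_at_right_less eventually_at_filter)
    then show "((\<lambda>r. r powr s) \<longlongrightarrow> 0) (at_right 0)" using assms(2) by simp
  qed auto
  show "antimono_on {0<..<1} (\<lambda>r. r powr - \<gamma> * r powr s)"
    using assms(3) by (auto simp: monotone_on_def powr_add[symmetric] intro!: powr_mono2')
qed (use assms in auto)

text \<open>
  Any divergent recurrence problem will do, since its limsup set lies in \<open>K\<close>; with \<open>\<phi> = 2\<close> the terms are a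
  multiple of \<open>(\<rho> powr s * L) ^ n\<close>, and the base exceeds \<open>1\<close>.
\<close>

lemma power_measure_infinite:
  assumes \<gamma>: "\<gamma> = ln (real L) / (- ln \<rho>)" and s: "0 < s" "s < \<gamma>"
  shows "hausdorff_measure K (\<lambda>r. r powr s) K = \<infinity>"
proof -
  interpret self_similar_gauge L \<rho> a K \<gamma> "\<lambda>r. r powr s" 1 by (rule power_gauge[OF assms])
  define q where "q = \<rho> powr s * real L"
  have "ln q > 0"
  proof -
    have "- ln \<rho> * s < - ln \<rho> * \<gamma>" using s(2) rho by (intro mult_strict_left_mono) auto
    also have "\<dots> = ln (real L)" using rho by (simp add: \<gamma>)
    finally show ?thesis using L2 rho by (simp add: q_def ln_mult ln_powr ac_simps)
  qed
  moreover have "q > 0" using L2 rho by (simp add: q_def)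
  ultimately have q: "q > 1" by simp
  have pow: "(\<rho> ^ n) powr s * real L ^ n = q ^ n" for n
    using rho by (simp add: q_def power_mult_distrib powr_realpow[symmetric] powr_powr mult.commute)
  have grow: "\<exists>m'\<ge>m. y \<le> (\<rho> ^ m') powr s * real L ^ m'" for y m
  proof -
    obtain k where "y < q ^ k" using real_arch_pow[OF q] by blast
    also have "\<dots> \<le> q ^ max m k" using q by (intro power_increasing) auto
    finally show ?thesis unfolding pow by (intro exI[of _ "max m k"]) auto
  qed
  have "\<not> summable (\<lambda>n. (\<rho> ^ n * 2) powr s * real L ^ n)"
  proof
    assume "summable (\<lambda>n. (\<rho> ^ n * 2) powr s * real L ^ n)"
    moreover have "(\<rho> ^ n * 2) powr s * real L ^ n = 2 powr s * q ^ n" for n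
      using rho pow[of n] by (simp add: powr_mult ac_simps)
    ultimately have "summable (\<lambda>n. q ^ n)" by simp
    then show False using q by (simp add: summable_geometric_iff)
  qed
  then have "hausdorff_measure K (\<lambda>r. r powr s) (recurrent_set \<rho> a L K (\<lambda>_. 2)) = \<infinity>"
    using grow by (intro measure_recurrent_set_infinite) auto
  moreover have "recurrent_set \<rho> a L K (\<lambda>_. 2) \<subseteq> K" by (auto simp: recurrent_set_def)
  ultimately show ?thesis
    using hausdorff_measure_mono[of "recurrent_set \<rho> a L K (\<lambda>_. 2)" K K "\<lambda>r. r powr s"]
    by (simp add: top_unique)
qed

lemma power_measure_zero:
  assumes \<gamma>: "\<gamma> = ln (real L) / (- ln \<rho>)" and s: "\<gamma> < s"
  shows "hausdorff_measure K (\<lambda>r. r powr s) K = 0"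
proof -
  define q where "q = \<rho> powr s * real L"
  have "ln q < 0"
  proof -
    have "ln (real L) = - ln \<rho> * \<gamma>" using rho by (simp add: \<gamma>)
    also have "\<dots> < - ln \<rho> * s" using s rho by (intro mult_strict_left_mono) auto
    finally show ?thesis using L2 rho by (simp add: q_def ln_mult ln_powr ac_simps)
  qed
  moreover have q0: "q > 0" using L2 rho by (simp add: q_def)
  ultimately have q: "q < 1" by simp
  have "hausdorff_content K (\<lambda>r. r powr s) \<tau> K \<le> 0" if \<tau>: "\<tau> > 0" for \<tau>
  proof (rule ennreal_le_epsilon)
    fix e :: real assume e: "0 < e"
    obtain m1 where m1: "\<And>n. m1 \<le> n \<Longrightarrow> \<rho> ^ n < \<tau> / 2" using small_scale_exists[of "\<tau> / 2"] \<tau> by auto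
    obtain m2 where m2: "q ^ m2 < e / 4 powr s" using real_arch_pow_inv[of "e / 4 powr s" q] e q by auto
    define M where "M = max m1 m2"
    have "q ^ M \<le> q ^ m2" using q q0 by (intro power_decreasing) (auto simp: M_def)
    then have "q ^ M \<le> e / 4 powr s" using m2 by linarith
    then have "4 powr s * q ^ M \<le> e" by (simp add: field_simps)
    have "hausdorff_content K (\<lambda>r. r powr s) \<tau> K \<le> ennreal (real (card (words L M)) * (4 * \<rho> ^ M) powr s)"
    proof (rule content_of_words_le)
      show "\<exists>\<omega>\<in>digits. x = point \<omega> \<and> map \<omega> [0..<M] \<in> words L M" if "x \<in> K" for x
        using that digits_word K_eq_points by blast
      show "2 * \<rho> ^ M \<le> \<tau>" using m1[of M] by (simp add: M_def)
    qed auto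
    also have "real (card (words L M)) * (4 * \<rho> ^ M) powr s = 4 powr s * q ^ M"
      using rho by (simp add: card_words q_def power_mult_distrib powr_mult powr_realpow[symmetric]
          powr_powr mult.commute)
    also have "\<dots> \<le> e" by fact
    finally show "hausdorff_content K (\<lambda>r. r powr s) \<tau> K \<le> 0 + ennreal e" by (simp add: ennreal_leI)
  qed
  then have "hausdorff_measure K (\<lambda>r. r powr s) K \<le> 0" by (rule hausdorff_measure_leI)
  then show ?thesis by simp
qed

text \<open>
  The constant gauge is not a dimension function, so the exponent \<open>0\<close> needs its own argument: every cover of \<open>K\<close> has
  at least one member.
\<close>

lemma power_zero_measure_nonzero: "hausdorff_measure K (\<lambda>r. r powr 0) K \<noteq> 0"
proof -
  have "1 \<le> hausdorff_content K (\<lambda>r. r powr 0) 1 K"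
    unfolding hausdorff_content_def
  proof (rule Inf_greatest, clarify)
    fix I x and r :: "nat \<Rightarrow> real" assume cover: "hausdorff_cover K 1 K I x r"
    then obtain i where i: "i \<in> I" using K_props(2) by (auto simp: hausdorff_cover_def)
    then have "r i > 0" using cover by (auto simp: hausdorff_cover_def)
    then have "1 = (\<Sum>i\<in>{i}. ennreal ((2 * r i) powr 0))" by simp
    also have "\<dots> \<le> (\<Sum>\<^sub>\<infinity>i\<in>I. ennreal ((2 * r i) powr 0))" using i by (intro sum_le_infsum_ennreal) auto
    finally show "1 \<le> (\<Sum>\<^sub>\<infinity>i\<in>I. ennreal ((2 * r i) powr 0))" .
  qed
  also have "\<dots> \<le> hausdorff_measure K (\<lambda>r. r powr 0) K" by (rule hausdorff_content_le_measure) simp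
  finally show ?thesis by auto
qed

theorem hausdorff_dim_attractor:
  assumes \<gamma>: "\<gamma> = ln (real L) / (- ln \<rho>)"
  shows "hausdorff_dim K K = ennreal \<gamma>"
proof (rule antisym)
  have \<gamma>0: "\<gamma> > 0" using L2 rho unfolding \<gamma> by (intro divide_pos_pos) auto
  show "hausdorff_dim K K \<le> ennreal \<gamma>"
  proof (rule ennreal_le_epsilon)
    fix e :: real assume e: "0 < e"
    have "hausdorff_dim K K \<le> ennreal (\<gamma> + e)"
      unfolding hausdorff_dim_def using \<gamma>0 e power_measure_zero[OF \<gamma>, of "\<gamma> + e"]
      by (intro INF_lower) simp
    then show "hausdorff_dim K K \<le> ennreal \<gamma> + ennreal e" using \<gamma>0 e by simp
  qed
  show "ennreal \<gamma> \<le> hausdorff_dim K K"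
    unfolding hausdorff_dim_def
  proof (rule INF_greatest)
    fix s assume "s \<in> {s. 0 \<le> s \<and> hausdorff_measure K (\<lambda>r. r powr s) K = 0}"
    then have s: "0 \<le> s" "hausdorff_measure K (\<lambda>r. r powr s) K = 0" by auto
    have "s \<noteq> 0" using power_zero_measure_nonzero s(2) by metis
    have "\<gamma> \<le> s"
    proof (rule ccontr)
      assume "\<not> \<gamma> \<le> s"
      then show False using power_measure_infinite[OF \<gamma>, of s] s \<open>s \<noteq> 0\<close> by simp
    qed
    then show "ennreal \<gamma> \<le> ennreal s" by (rule ennreal_leI)
  qed
qed

end

section \<open>The zero-full law for recurrence\<close>

theorem theorem1p4:
  fixes L :: nat and \<rho> \<gamma> :: real and a :: "nat \<Rightarrow> real" and K :: "real set"
    and \<phi> :: "nat \<Rightarrow> real" and f :: "real \<Rightarrow> real"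
  assumes "2 \<le> L" and "0 < \<rho>" and "\<rho> < 1"
    and "strict_mono_on {1..L} a" and "0 \<le> a 1" and "a L \<le> 1 - \<rho>"
    and "is_attractor \<rho> a L K"
    and "strong_separation \<rho> a L K"
    and "\<gamma> = ln (real L) / (- ln \<rho>)"
    and "\<And>n. 1 \<le> n \<Longrightarrow> 0 < \<phi> n"
    and "dimension_function f" and "doubling f"
    and "increasing_towards_0 (\<lambda>r. r powr (- \<gamma>) * f r)"
  shows "hausdorff_dim K K = ennreal \<gamma> \<and>
    ((\<Sum>\<^sub>\<infinity>n\<in>{1..}. ennreal (f (\<rho> ^ n * \<phi> n) * \<rho> powr (- \<gamma> * real n))) < \<infinity> \<longrightarrow>
       hausdorff_measure K f (recurrent_set \<rho> a L K \<phi>) = 0) \<and>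
    ((\<Sum>\<^sub>\<infinity>n\<in>{1..}. ennreal (f (\<rho> ^ n * \<phi> n) * \<rho> powr (- \<gamma> * real n))) = \<infinity> \<longrightarrow>
       hausdorff_measure K f (recurrent_set \<rho> a L K \<phi>) = hausdorff_measure K f K)"
proof -
  interpret self_similar_set L \<rho> a K by unfold_locales (fact assms)+
  obtain r0 where "r0 > 0" "antimono_on {0<..<r0} (\<lambda>r. r powr (- \<gamma>) * f r)"
    using assms(13) unfolding increasing_towards_0_def by blast
  then interpret self_similar_gauge L \<rho> a K \<gamma> f r0 by unfold_locales (use assms in auto)
  let ?A = "\<lambda>n. f (\<rho> ^ n * \<phi> n) * real L ^ n"
  let ?S = "\<Sum>\<^sub>\<infinity>n\<in>{1..}. ennreal (f (\<rho> ^ n * \<phi> n) * \<rho> powr (- \<gamma> * real n))"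
  have "0 \<le> ?A n" if "1 \<le> n" for n
    using f_pos[of "\<rho> ^ n * \<phi> n"] assms(10)[OF that] rho by simp
  then have S: "?S < \<infinity> \<longleftrightarrow> summable ?A"
    unfolding rho_powr_gamma by (rule infsum_ennreal_finite_iff_summable)
  have "hausdorff_measure K f (recurrent_set \<rho> a L K \<phi>) = 0" if "?S < \<infinity>"
    using that S by (intro measure_recurrent_set_null assms(10)) auto
  moreover have "hausdorff_measure K f (recurrent_set \<rho> a L K \<phi>) = hausdorff_measure K f K" if "?S = \<infinity>"
  proof -
    have div: "\<not> summable ?A" using S that by simp
    obtain m where m: "\<And>n. m \<le> n \<Longrightarrow> \<rho> ^ n < r0" using small_scale_exists[OF r0(1)] by blast
    show ?thesis
    proof (cases "\<exists>G. \<forall>m'\<ge>m. F m' * real L ^ m' \<le> G")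
      case True
      then obtain G where "\<forall>m'\<ge>m. F m' * real L ^ m' \<le> G" ..
      then show ?thesis using measure_recurrent_set_full[OF assms(10) div, of m G] by blast
    next
      case False
      have "\<exists>m'\<ge>k. y \<le> F m' * real L ^ m'" for y k
      proof -
        obtain m' where m': "m \<le> m'" "y < F m' * real L ^ m'" using False by (meson not_le)
        have "F m' * real L ^ m' \<le> F (max k m') * real L ^ max k m'"
          using m'(1) m by (intro g_mono) auto
        then show ?thesis using m'(2) by (intro exI[of _ "max k m'"]) auto
      qed
      then have inf: "hausdorff_measure K f (recurrent_set \<rho> a L K \<phi>) = \<infinity>"
        by (intro measure_recurrent_set_infinite[OF assms(10) div])
      have "recurrent_set \<rho> a L K \<phi> \<subseteq> K" by (auto simp: recurrent_set_def)
      then have "hausdorff_measure K f (recurrent_set \<rho> a L K \<phi>) \<le> hausdorff_measure K f K"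
        by (rule hausdorff_measure_mono)
      then show ?thesis using inf by (simp add: top_unique)
    qed
  qed
  ultimately show ?thesis using hausdorff_dim_attractor[OF assms(9)] by blast
qed

end
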